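(* Let $n=2$, $r\in\mathbb{N}$ and $K=K_r=\{\mathbf{k}\in\mathbb{Z}^2_+:|\mathbf{k}|\le r\}$. Let the truncated moment problem $$\int\mathbf{t}^{\mathbf{k}}\,d\mu(\mathbf{t})=s_{\mathbf{k}},\qquad\mathbf{k}\in\mathcal{K}=K+K,$$ with some real moments $\mathcal{S}=(s_{\mathbf{k}})_{\mathbf{k}\in\mathcal{K}}$, $s_{(0,0)}>0$, be given. Choose and fix an indexation $K=\{\mathbf{k}_j\}_{j=0}^{\rho}$ such that the elements of $K_{r-1}$ are indexed first, and then the rest of $K_r$. Assume that $\Gamma\ge0$ and $\operatorname{Ker}\Gamma_l\subseteq\operatorname{Ker}\widehat\Gamma_l$, $l=1,2$. Let $H$ be the associated Hilbert space, $M_1,M_2$ the associated symmetric operators, $i_s=\dim(H\ominus H_0)$, and let $A_k,B_k$ ($k=1,2$) be the matrices $$A_k=\left((M_kg_l,g_j)_H\right)_{j,l=0}^{d},\qquad B_k=\left((M_kg_l,g_j)_H\right)_{j=d+1,\dots,d+i_s;\ l=0,\dots,d},$$ where $\{g_j\}_{j=0}^{d+i_s}$ is the orthonormal basis of $H$ obtained by the Gram--Schmidt procedure from $[\mathbf{t}^{\mathbf{k}_0}],\dots,[\mathbf{t}^{\mathbf{k}_\rho}]$. Suppose that $i_s>0$ and that $$A_1A_2+B_1^*B_2=A_2A_1+B_2^*B_1,\qquad \operatorname{Tr}(B_2B_1^*-B_1B_2^* )=0.$$ Then the moment problem has a canonical solution if and only if there exist Hermitian complex matrices $C_1,C_2$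 of size $i_s\times i_s$ such that $$B_2^*C_1-B_1^*C_2=A_1B_2^*-A_2B_1^*\qquad\text{and}\qquad C_1C_2-C_2C_1=B_2B_1^*-B_1B_2^*.$$
   Context: Notation (here $n=2$): $\mathbb{Z}_+$ is the set of non-negative integers; for $\mathbf{k}=(k_1,k_2)\in\mathbb{Z}^2_+$ and $\mathbf{t}=(t_1,t_2)\in\mathbb{R}^2$, $\mathbf{t}^{\mathbf{k}}=t_1^{k_1}t_2^{k_2}$ and $|\mathbf{k}|=k_1+k_2$; $\vec e_1=(1,0)$, $\vec e_2=(0,1)$; $\mathfrak{B}(\mathbb{R}^2)$ is the Borel $\sigma$-algebra. A solution of the moment problem is a non-negative measure $\mu$ on $\mathfrak{B}(\mathbb{R}^2)$ satisfying the displayed equalities. $K_{r-1}=\{\mathbf{k}\in\mathbb{Z}^2_+:|\mathbf{k}|\le r-1\}$. Matrices: for $l=1,2$ put $\Omega_l=\{j\in\{0,\dots,\rho\}:\mathbf{k}_j+\vec e_l\in K\}$, and put $\Omega_0=\{j\in\{0,\dots,\rho\}:\mathbf{k}_j+\vec e_1,\mathbf{k}_j+\vec e_2\in K\}$ (for $K=K_r$ one has $\Omega_0=\Omega_1=\Omega_2=\{j:\mathbf{k}_j\in K_{r-1}\}$). Define $$\Gamma=(s_{\mathbf{k}_j+\mathbf{k}_m})_{m,j=0}^{\rho},\quad \Gamma_l=(s_{\mathbf{k}_j+\mathbf{k}_m})_{m,j\in\Omega_l},\quad \widehat\Gamma_l=(s_{\mathbf{k}_j+\vec e_l+\mathbf{k}_m+\vec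 e_l})_{m,j\in\Omega_l},\quad l=1,2,$$ with indices from $\Omega_l$ taken in increasing order. $\Gamma\ge0$ means positive semidefinite. Associated Hilbert space: let $\mathfrak{L}$ be the complex vector space of polynomials $p(\mathbf{t})=\sum_{j=0}^{\rho}\alpha_j\mathbf{t}^{\mathbf{k}_j}$, $\alpha_j\in\mathbb{C}$, with the sesquilinear form $\langle p,q\rangle=\sum_{j,m=0}^{\rho}\alpha_j\overline{\beta_m}s_{\mathbf{k}_j+\mathbf{k}_m}$ for $q=\sum_{j=0}^\rho\beta_j\mathbf{t}^{\mathbf{k}_j}$. Since $\Gamma\ge0$, this form is positive semidefinite; $H$ is the finite-dimensional Hilbert space obtained as the quotient of $\mathfrak{L}$ by the null space of the form, $(\cdot,\cdot)_H$ is its scalar product (linear in the first argument), and $[p]$ denotes the class of $p$. Operators: let $H_0=\operatorname{Lin}\{[\mathbf{t}^{\mathbf{k}_j}]\}_{j\in\Omega_0}$. For $l=1,2$, $M_l$ is the linear operator in $H$ with domain $D(M_l)=\operatorname{Lin}\{[\mathbf{t}^{\mathbf{k}_j}]\}_{j\in\Omega_l}=H_0$ given by $M_l\sum_{j\in\Omega_l}\alpha_j[\mathbf{t}^{\mathbf{k}_j}]=\sum_{j\in\Omega_l}\alpha_j[\mathbf{t}^{\mathbf{k}_j+\vec e_l}]$, $\alpha_j\in\mathbb{C}$; it is well defined because of the kernel conditions, and it is symmetric. The number $i_s=\dim(H\ominus H_0)$ is called the index of nonself-adjointness of $\mathcal{S}$. Basis: applying Gram--Schmidt orthogonalization (with normalization,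 discarding linearly dependent elements) to the sequence $[\mathbf{t}^{\mathbf{k}_j}]$, $j=0,1,\dots,\rho$, gives an orthonormal basis $\{g_j\}_{j=0}^{d+i_s}$ of $H$, where $\dim H_0=d+1$, $\dim H=d+i_s+1$, and $\{g_j\}_{j=0}^{d}$ is an orthonormal basis of $H_0$. In the matrices $A_k,B_k$ the index $j$ numbers rows and $l$ numbers columns; ${}^*$ denotes the conjugate transpose and $\operatorname{Tr}$ the trace. Canonical solution: a solution $\mu$ of the moment problem is canonical if there exist commuting self-adjoint operators $\widetilde M_1,\widetilde M_2$ on $H$ with $\widetilde M_j\supseteq M_j$ ($j=1,2$) such that $\mu(\delta)=(E(\delta)[1],[1])_H$ for all $\delta\in\mathfrak{B}(\mathbb{R}^2)$, where $E$ is the joint spectral measure of the commuting pair $\widetilde M_1,\widetilde M_2$. *)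

theory Defs
  imports
    "HOL-Analysis.Bochner_Integration"
    "HOL-Library.Poly_Mapping"
    "HOL-Library.Product_Plus"
    "Jordan_Normal_Form.Matrix_Kernel"
    "Jordan_Normal_Form.Schur_Decomposition"
begin

hide_const (open) Polynomial.smult Multiset.mult

section \<open>Complex inner product spaces with an explicit carrier\<close>

text \<open>
  A complex vector space is a module record over \<^term>\<open>class_ring :: complex ring\<close>, as for
  \<^const>\<open>module_vec\<close>; the extra field is a form that is linear in its first argument.
\<close>

record 'v ip_module = "(complex, 'v) module" +
  ip :: "'v \<Rightarrow> 'v \<Rightarrow> complex"

abbreviation lin :: "('v, 'z) ip_module_scheme \<Rightarrow> 'v set \<Rightarrow> 'v set" where
  "lin V S \<equiv> LinearCombinations.module.span class_ring V S"

abbreviation subdim :: "('v, 'z) ip_module_scheme \<Rightarrow> 'v set \<Rightarrow> nat" where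
  "subdim V W \<equiv> vectorspace.dim class_ring (V\<lparr>carrier := W\<rparr>)"

definition orth_compl :: "('v, 'z) ip_module_scheme \<Rightarrow> 'v set \<Rightarrow> 'v set" where
  "orth_compl V W = {x \<in> carrier V. \<forall>y \<in> W. ip V x y = 0}"

definition ip_norm :: "('v, 'z) ip_module_scheme \<Rightarrow> 'v \<Rightarrow> real" where
  "ip_norm V x = sqrt (Re (ip V x x))"

definition gram_schmidt_step ::
    "('v, 'z) ip_module_scheme \<Rightarrow> 'v list \<Rightarrow> 'v \<Rightarrow> 'v list" where
  "gram_schmidt_step V gs v =
     (let w = v \<ominus>\<^bsub>V\<^esub> (\<Oplus>\<^bsub>V\<^esub> i \<in> {..<length gs}. ip V v (gs ! i) \<odot>\<^bsub>V\<^esub> (gs ! i))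
      in if w = \<zero>\<^bsub>V\<^esub> then gs
         else gs @ [complex_of_real (1 / ip_norm V w) \<odot>\<^bsub>V\<^esub> w])"

definition gram_schmidt_basis :: "('v, 'z) ip_module_scheme \<Rightarrow> 'v list \<Rightarrow> 'v list" where
  "gram_schmidt_basis V vs = foldl (gram_schmidt_step V) [] vs"

text \<open>
  The spaces considered are finite-dimensional, where a densely defined operator is defined
  everywhere; hence self-adjoint operators are total on the carrier.
\<close>

definition self_adjoint_op :: "('v, 'z) ip_module_scheme \<Rightarrow> ('v \<Rightarrow> 'v) \<Rightarrow> bool" where
  "self_adjoint_op V T \<longleftrightarrow>
     T \<in> LinearCombinations.module_hom class_ring V V \<and>
     (\<forall>x \<in> carrier V. \<forall>y \<in> carrier V. ip V (T x) y = ip V x (T y))"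

definition commuting_ops ::
    "('v, 'z) ip_module_scheme \<Rightarrow> ('v \<Rightarrow> 'v) \<Rightarrow> ('v \<Rightarrow> 'v) \<Rightarrow> bool" where
  "commuting_ops V T U \<longleftrightarrow> (\<forall>x \<in> carrier V. T (U x) = U (T x))"

definition orth_projection :: "('v, 'z) ip_module_scheme \<Rightarrow> ('v \<Rightarrow> 'v) \<Rightarrow> bool" where
  "orth_projection V P \<longleftrightarrow> self_adjoint_op V P \<and> (\<forall>x \<in> carrier V. P (P x) = P x)"

text \<open>
  Countable additivity is required weakly; for orthogonal projections this is equivalent to
  strong countable additivity.
\<close>

definition spectral_measure ::
    "('v, 'z) ip_module_scheme \<Rightarrow> ((real \<times> real) set \<Rightarrow> 'v \<Rightarrow> 'v) \<Rightarrow> bool" where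
  "spectral_measure V E \<longleftrightarrow>
     (\<forall>\<delta> \<in> sets borel. orth_projection V (E \<delta>)) \<and>
     (\<forall>x \<in> carrier V. E UNIV x = x) \<and>
     (\<forall>F :: nat \<Rightarrow> (real \<times> real) set. range F \<subseteq> sets borel \<longrightarrow> disjoint_family F \<longrightarrow>
        (\<forall>x \<in> carrier V. \<forall>y \<in> carrier V.
           (\<lambda>i. ip V (E (F i) x) y) sums ip V (E (\<Union>i. F i) x) y))"

definition diagonal_measure ::
    "('v, 'z) ip_module_scheme \<Rightarrow> ((real \<times> real) set \<Rightarrow> 'v \<Rightarrow> 'v) \<Rightarrow> 'v \<Rightarrow> (real \<times> real) measure" where
  "diagonal_measure V E x =
     measure_of UNIV (sets borel) (\<lambda>\<delta>. ennreal (Re (ip V (E \<delta> x) x)))"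

text \<open>
  \<open>T = \<integral> f dE\<close> for an everywhere defined \<open>T\<close>: the square integrability says that every vector is
  in the domain of the integral, and by polarization the quadratic form determines \<open>T\<close>.
\<close>

definition spectral_integral ::
    "('v, 'z) ip_module_scheme \<Rightarrow> ((real \<times> real) set \<Rightarrow> 'v \<Rightarrow> 'v) \<Rightarrow>
     (real \<times> real \<Rightarrow> real) \<Rightarrow> ('v \<Rightarrow> 'v) \<Rightarrow> bool" where
  "spectral_integral V E f T \<longleftrightarrow>
     (\<forall>x \<in> carrier V.
        integrable (diagonal_measure V E x) (\<lambda>t. (f t)\<^sup>2) \<and>
        ip V (T x) x = complex_of_real (integral\<^sup>L (diagonal_measure V E x) f))"

definition joint_spectral_measure ::
    "('v, 'z) ip_module_scheme \<Rightarrow> ((real \<times> real) set \<Rightarrow> 'v \<Rightarrow> 'v) \<Rightarrow>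
     ('v \<Rightarrow> 'v) \<Rightarrow> ('v \<Rightarrow> 'v) \<Rightarrow> bool" where
  "joint_spectral_measure V E T1 T2 \<longleftrightarrow>
     spectral_measure V E \<and> spectral_integral V E fst T1 \<and> spectral_integral V E snd T2"


section \<open>Matrices\<close>

text \<open>
  In the order on \<^typ>\<open>complex\<close>, \<open>0 \<le> z\<close> includes that \<open>z\<close> is real, so this covers Hermitian symmetry.
\<close>

definition psd_mat :: "complex mat \<Rightarrow> bool" where
  "psd_mat X \<longleftrightarrow> (\<forall>v \<in> carrier_vec (dim_col X). 0 \<le> (X *\<^sub>v v) \<bullet>c v)"

definition hermitian_mat :: "complex mat \<Rightarrow> bool" where
  "hermitian_mat X \<longleftrightarrow> square_mat X \<and> mat_adjoint X = X"

definition mat_trace :: "complex mat \<Rightarrow> complex" where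
  "mat_trace X = (\<Sum>i<dim_row X. X $$ (i, i))"


section \<open>The truncated moment problem in two variables\<close>

definition K_deg :: "nat \<Rightarrow> (nat \<times> nat) set" where
  "K_deg r = {k. fst k + snd k \<le> r}"

definition moment_solution ::
    "(nat \<times> nat \<Rightarrow> real) \<Rightarrow> (nat \<times> nat) set \<Rightarrow> (real \<times> real) measure \<Rightarrow> bool" where
  "moment_solution s K \<mu> \<longleftrightarrow>
     sets \<mu> = sets borel \<and>
     (\<forall>k \<in> {p + q | p q. p \<in> K \<and> q \<in> K}.
        integrable \<mu> (\<lambda>t. fst t ^ fst k * snd t ^ snd k) \<and>
        (\<integral>t. fst t ^ fst k * snd t ^ snd k \<partial>\<mu>) = s k)"

definition unit_index :: "nat \<Rightarrow> nat \<times> nat" where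
  "unit_index l = (if l = 1 then (1, 0) else (0, 1))"

text \<open>
  Throughout, \<open>k\<close> restricted to \<open>{0..\<rho>}\<close> is the indexation, so that \<open>K\<close> is \<^term>\<open>k ` {0..\<rho>}\<close>.
\<close>

definition Omega :: "(nat \<Rightarrow> nat \<times> nat) \<Rightarrow> nat \<Rightarrow> nat \<Rightarrow> nat set" where
  "Omega k \<rho> l = {j \<in> {0..\<rho>}. k j + unit_index l \<in> k ` {0..\<rho>}}"

definition Omega0 :: "(nat \<Rightarrow> nat \<times> nat) \<Rightarrow> nat \<Rightarrow> nat set" where
  "Omega0 k \<rho> = {j \<in> {0..\<rho>}. k j + unit_index 1 \<in> k ` {0..\<rho>} \<and> k j + unit_index 2 \<in> k ` {0..\<rho>}}"

definition Gamma :: "(nat \<times> nat \<Rightarrow> real) \<Rightarrow> (nat \<Rightarrow> nat \<times> nat) \<Rightarrow> nat \<Rightarrow> complex mat" where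
  "Gamma s k \<rho> = Matrix.mat (\<rho> + 1) (\<rho> + 1) (\<lambda>(m, j). complex_of_real (s (k j + k m)))"

definition Gamma_sub ::
    "(nat \<times> nat \<Rightarrow> real) \<Rightarrow> (nat \<Rightarrow> nat \<times> nat) \<Rightarrow> nat \<Rightarrow> nat \<Rightarrow> complex mat" where
  "Gamma_sub s k \<rho> l =
     (let \<omega> = sorted_list_of_set (Omega k \<rho> l)
      in Matrix.mat (length \<omega>) (length \<omega>)
           (\<lambda>(m, j). complex_of_real (s (k (\<omega> ! j) + k (\<omega> ! m)))))"

definition Gamma_hat ::
    "(nat \<times> nat \<Rightarrow> real) \<Rightarrow> (nat \<Rightarrow> nat \<times> nat) \<Rightarrow> nat \<Rightarrow> nat \<Rightarrow> complex mat" where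
  "Gamma_hat s k \<rho> l =
     (let \<omega> = sorted_list_of_set (Omega k \<rho> l)
      in Matrix.mat (length \<omega>) (length \<omega>)
           (\<lambda>(m, j). complex_of_real
              (s (k (\<omega> ! j) + unit_index l + k (\<omega> ! m) + unit_index l))))"


section \<open>The associated Hilbert space and operators\<close>

text \<open>
  Polynomials in \<open>t\<^sub>1, t\<^sub>2\<close> with complex coefficients; \<open>Poly_Mapping.single k c\<close> is \<open>c t\<^sup>k\<close>.
\<close>

type_synonym poly2 = "(nat \<times> nat) \<Rightarrow>\<^sub>0 complex"

definition poly_space :: "(nat \<Rightarrow> nat \<times> nat) \<Rightarrow> nat \<Rightarrow> poly2 set" where
  "poly_space k \<rho> = {p. Poly_Mapping.keys p \<subseteq> k ` {0..\<rho>}}"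

definition poly_form ::
    "(nat \<times> nat \<Rightarrow> real) \<Rightarrow> (nat \<Rightarrow> nat \<times> nat) \<Rightarrow> nat \<Rightarrow> poly2 \<Rightarrow> poly2 \<Rightarrow> complex" where
  "poly_form s k \<rho> p q =
     (\<Sum>j\<in>{0..\<rho>}. \<Sum>m\<in>{0..\<rho>}.
        Poly_Mapping.lookup p (k j) * cnj (Poly_Mapping.lookup q (k m)) * complex_of_real (s (k j + k m)))"

definition null_rel ::
    "(nat \<times> nat \<Rightarrow> real) \<Rightarrow> (nat \<Rightarrow> nat \<times> nat) \<Rightarrow> nat \<Rightarrow> (poly2 \<times> poly2) set" where
  "null_rel s k \<rho> =
     {(p, q). p \<in> poly_space k \<rho> \<and> q \<in> poly_space k \<rho> \<and> poly_form s k \<rho> (p - q) (p - q) = 0}"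

definition cls ::
    "(nat \<times> nat \<Rightarrow> real) \<Rightarrow> (nat \<Rightarrow> nat \<times> nat) \<Rightarrow> nat \<Rightarrow> poly2 \<Rightarrow> poly2 set" where
  "cls s k \<rho> p = null_rel s k \<rho> `` {p}"

text \<open>The fields \<^const>\<open>mult\<close> and \<^const>\<open>one\<close> of a module record are not used.\<close>

definition H_space ::
    "(nat \<times> nat \<Rightarrow> real) \<Rightarrow> (nat \<Rightarrow> nat \<times> nat) \<Rightarrow> nat \<Rightarrow> poly2 set ip_module" where
  "H_space s k \<rho> =
     \<lparr>carrier = poly_space k \<rho> // null_rel s k \<rho>,
      mult = undefined,
      one = undefined,
      zero = cls s k \<rho> 0,
      add = (\<lambda>X Y. \<Union>p\<in>X. \<Union>q\<in>Y. cls s k \<rho> (p + q)),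
      smult = (\<lambda>c X. \<Union>p\<in>X. cls s k \<rho> (Poly_Mapping.single 0 c * p)),
      ip = (\<lambda>X Y. the_elem (\<Union>p\<in>X. \<Union>q\<in>Y. {poly_form s k \<rho> p q}))\<rparr>"

definition H0_sub ::
    "(nat \<times> nat \<Rightarrow> real) \<Rightarrow> (nat \<Rightarrow> nat \<times> nat) \<Rightarrow> nat \<Rightarrow> poly2 set set" where
  "H0_sub s k \<rho> =
     lin (H_space s k \<rho>) ((\<lambda>j. cls s k \<rho> (Poly_Mapping.single (k j) 1)) ` Omega0 k \<rho>)"

definition M_dom ::
    "(nat \<times> nat \<Rightarrow> real) \<Rightarrow> (nat \<Rightarrow> nat \<times> nat) \<Rightarrow> nat \<Rightarrow> nat \<Rightarrow> poly2 set set" where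
  "M_dom s k \<rho> l =
     lin (H_space s k \<rho>) ((\<lambda>j. cls s k \<rho> (Poly_Mapping.single (k j) 1)) ` Omega k \<rho> l)"

text \<open>
  The value on \<^const>\<open>M_dom\<close> is unique if \<^const>\<open>Gamma\<close> is positive semidefinite and the kernel of
  \<^const>\<open>Gamma_sub\<close> is contained in that of \<^const>\<open>Gamma_hat\<close>.
\<close>

definition M_op ::
    "(nat \<times> nat \<Rightarrow> real) \<Rightarrow> (nat \<Rightarrow> nat \<times> nat) \<Rightarrow> nat \<Rightarrow> nat \<Rightarrow> poly2 set \<Rightarrow> poly2 set" where
  "M_op s k \<rho> l X =
     (THE Y. \<exists>\<alpha> :: nat \<Rightarrow> complex.
        X = cls s k \<rho> (\<Sum>j\<in>Omega k \<rho> l. Poly_Mapping.single (k j) (\<alpha> j)) \<and>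
        Y = cls s k \<rho> (\<Sum>j\<in>Omega k \<rho> l. Poly_Mapping.single (k j + unit_index l) (\<alpha> j)))"

definition nsa_index :: "(nat \<times> nat \<Rightarrow> real) \<Rightarrow> (nat \<Rightarrow> nat \<times> nat) \<Rightarrow> nat \<Rightarrow> nat" where
  "nsa_index s k \<rho> = subdim (H_space s k \<rho>) (orth_compl (H_space s k \<rho>) (H0_sub s k \<rho>))"

text \<open>This is \<open>d + 1\<close>, so the basis elements from this index on are \<open>g\<^bsub>d+1\<^esub>, g\<^bsub>d+2\<^esub>, \<dots>\<close>\<close>

definition H0_dim :: "(nat \<times> nat \<Rightarrow> real) \<Rightarrow> (nat \<Rightarrow> nat \<times> nat) \<Rightarrow> nat \<Rightarrow> nat" where
  "H0_dim s k \<rho> = subdim (H_space s k \<rho>) (H0_sub s k \<rho>)"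

definition g_basis ::
    "(nat \<times> nat \<Rightarrow> real) \<Rightarrow> (nat \<Rightarrow> nat \<times> nat) \<Rightarrow> nat \<Rightarrow> poly2 set list" where
  "g_basis s k \<rho> =
     gram_schmidt_basis (H_space s k \<rho>)
       (map (\<lambda>j. cls s k \<rho> (Poly_Mapping.single (k j) 1)) [0..<\<rho> + 1])"

definition A_mat ::
    "(nat \<times> nat \<Rightarrow> real) \<Rightarrow> (nat \<Rightarrow> nat \<times> nat) \<Rightarrow> nat \<Rightarrow> nat \<Rightarrow> complex mat" where
  "A_mat s k \<rho> i =
     Matrix.mat (H0_dim s k \<rho>) (H0_dim s k \<rho>)
       (\<lambda>(j, l). ip (H_space s k \<rho>) (M_op s k \<rho> i (g_basis s k \<rho> ! l)) (g_basis s k \<rho> ! j))"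

definition B_mat ::
    "(nat \<times> nat \<Rightarrow> real) \<Rightarrow> (nat \<Rightarrow> nat \<times> nat) \<Rightarrow> nat \<Rightarrow> nat \<Rightarrow> complex mat" where
  "B_mat s k \<rho> i =
     Matrix.mat (nsa_index s k \<rho>) (H0_dim s k \<rho>)
       (\<lambda>(j, l). ip (H_space s k \<rho>) (M_op s k \<rho> i (g_basis s k \<rho> ! l))
                   (g_basis s k \<rho> ! (H0_dim s k \<rho> + j)))"

definition canonical_solution ::
    "(nat \<times> nat \<Rightarrow> real) \<Rightarrow> (nat \<Rightarrow> nat \<times> nat) \<Rightarrow> nat \<Rightarrow> (real \<times> real) measure \<Rightarrow> bool" where
  "canonical_solution s k \<rho> \<mu> \<longleftrightarrow>
     moment_solution s (k ` {0..\<rho>}) \<mu> \<and>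
     (\<exists>T1 T2 E.
        self_adjoint_op (H_space s k \<rho>) T1 \<and>
        self_adjoint_op (H_space s k \<rho>) T2 \<and>
        commuting_ops (H_space s k \<rho>) T1 T2 \<and>
        (\<forall>x \<in> M_dom s k \<rho> 1. T1 x = M_op s k \<rho> 1 x) \<and>
        (\<forall>x \<in> M_dom s k \<rho> 2. T2 x = M_op s k \<rho> 2 x) \<and>
        joint_spectral_measure (H_space s k \<rho>) E T1 T2 \<and>
        (\<forall>\<delta> \<in> sets borel.
           complex_of_real (measure \<mu> \<delta>) =
             ip (H_space s k \<rho>) (E \<delta> (cls s k \<rho> 1)) (cls s k \<rho> 1)))"

end

theory Submission
  imports Defs
begin

text \<open>
  Write \<open>H = H\<^sub>0 \<oplus> H\<^sub>0\<^sup>\<bottom>\<close>. The Gram--Schmidt basis is adapted to this decomposition because the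
  exponents of degree below \<open>r\<close> are listed first (\<open>g_basis_split\<close>). In this basis a self-adjoint
  operator that extends \<open>M\<^sub>l\<close> has the block matrix with rows \<open>(A\<^sub>l, B\<^sub>l\<^sup>*)\<close> and \<open>(B\<^sub>l, C\<^sub>l)\<close>: the
  operator \<open>M\<^sub>l\<close> prescribes the first column of blocks, self-adjointness the first row, and \<open>C\<^sub>l\<close> can be
  an arbitrary Hermitian matrix of size \<open>i\<^sub>s\<close> (\<open>matrix_of_extension\<close>, \<open>extension_of_matrix\<close>). Two such
  matrices commute if and only if the four blocks of the two products agree. The upper left blocks
  agree by hypothesis, the equation for the upper right blocks is the first condition on \<open>C\<^sub>1, C\<^sub>2\<close>,
  the equation for the lower left blocks is its adjoint, and the equation for the lower right blocks
  is the commutator condition (\<open>selfadjoint_block_commute_iff\<close>). So the matrices \<open>C\<^sub>1, C\<^sub>2\<close> exist if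
  and only if \<open>M\<^sub>1, M\<^sub>2\<close> have commuting self-adjoint extensions in \<open>H\<close>.

  A canonical solution comes with such extensions by definition. Conversely, let \<open>T\<^sub>1, T\<^sub>2\<close> be
  commuting self-adjoint extensions. They have an orthonormal basis \<open>u\<^sub>i\<close> of joint eigenvectors with
  eigenvalues \<open>a\<^sub>i, b\<^sub>i\<close> (\<open>joint_eigenbasis\<close>); the joint spectral measure is the sum of the
  projections onto the \<open>u\<^sub>i\<close>, placed at the points \<open>(a\<^sub>i, b\<^sub>i)\<close>, and \<open>\<mu>\<close> is the measure with mass
  \<open>\<bar>\<langle>1, u\<^sub>i\<rangle>\<bar>\<^sup>2\<close> there. Since \<open>T\<^sub>l\<close> acts as multiplication by \<open>t\<^sub>l\<close> on monomials of degree below \<open>r\<close>,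
  one has \<open>\<langle>t\<^sup>m, u\<^sub>i\<rangle> = a\<^sub>i\<^sup>m\<^sup>1 b\<^sub>i\<^sup>m\<^sup>2 \<langle>1, u\<^sub>i\<rangle>\<close> for \<open>m = (m1, m2)\<close> of degree at most \<open>r\<close>
  (\<open>ip_monomial_eigenvector\<close>), and Parseval's identity turns the moment
  \<open>s(x + y) = \<langle>t\<^sup>x, t\<^sup>y\<rangle>\<close> into the integral of \<open>t\<^sup>x\<^sup>+\<^sup>y\<close> (\<open>canonical_solution_exists\<close>).
\<close>

unbundle no vec_syntax

section \<open>Inner product spaces\<close>

locale ip_space = vectorspace "class_ring :: complex ring" V
  for V :: "('v, 'z) ip_module_scheme" +
  assumes ip_add_left [simp]: "\<lbrakk>x \<in> carrier V; y \<in> carrier V; z \<in> carrier V\<rbrakk>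
      \<Longrightarrow> ip V (x \<oplus>\<^bsub>V\<^esub> y) z = ip V x z + ip V y z"
    and ip_smult_left [simp]: "\<lbrakk>x \<in> carrier V; z \<in> carrier V\<rbrakk>
      \<Longrightarrow> ip V (c \<odot>\<^bsub>V\<^esub> x) z = c * ip V x z"
    and ip_cnj: "\<lbrakk>x \<in> carrier V; y \<in> carrier V\<rbrakk> \<Longrightarrow> ip V y x = cnj (ip V x y)"
    and ip_pos: "\<lbrakk>x \<in> carrier V; x \<noteq> \<zero>\<^bsub>V\<^esub>\<rbrakk> \<Longrightarrow> 0 < Re (ip V x x)"
begin

lemma ip_add_right [simp]: "\<lbrakk>x \<in> carrier V; y \<in> carrier V; z \<in> carrier V\<rbrakk>
    \<Longrightarrow> ip V z (x \<oplus>\<^bsub>V\<^esub> y) = ip V z x + ip V z y"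
  using ip_cnj[of "x \<oplus>\<^bsub>V\<^esub> y" z] ip_cnj[of x z] ip_cnj[of y z] by simp

lemma ip_smult_right [simp]: "\<lbrakk>x \<in> carrier V; z \<in> carrier V\<rbrakk>
    \<Longrightarrow> ip V z (c \<odot>\<^bsub>V\<^esub> x) = cnj c * ip V z x"
  using ip_cnj[of "c \<odot>\<^bsub>V\<^esub> x" z] ip_cnj[of x z] by simp

lemma ip_zero_left [simp]: "x \<in> carrier V \<Longrightarrow> ip V \<zero>\<^bsub>V\<^esub> x = 0"
  using ip_smult_left[of "\<zero>\<^bsub>V\<^esub>" x 0] by simp

lemma ip_zero_right [simp]: "x \<in> carrier V \<Longrightarrow> ip V x \<zero>\<^bsub>V\<^esub> = 0"
  using ip_cnj[of "\<zero>\<^bsub>V\<^esub>" x] by simp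

lemma ip_self_real: "x \<in> carrier V \<Longrightarrow> ip V x x = complex_of_real (Re (ip V x x))"
  using ip_cnj[of x x] by (simp add: complex_eq_iff)

lemma ip_self_eq_0: "x \<in> carrier V \<Longrightarrow> ip V x x = 0 \<longleftrightarrow> x = \<zero>\<^bsub>V\<^esub>"
  by (cases "x = \<zero>\<^bsub>V\<^esub>") (use ip_pos[of x] in auto)

lemma ip_uminus_left [simp]:
  "\<lbrakk>x \<in> carrier V; z \<in> carrier V\<rbrakk> \<Longrightarrow> ip V (\<ominus>\<^bsub>V\<^esub> x) z = - ip V x z"
  using ip_add_left[of x "\<ominus>\<^bsub>V\<^esub> x" z] by (simp add: r_neg eq_neg_iff_add_eq_0 add.commute)

lemma ip_minus_left [simp]: "\<lbrakk>x \<in> carrier V; y \<in> carrier V; z \<in> carrier V\<rbrakk>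
    \<Longrightarrow> ip V (x \<ominus>\<^bsub>V\<^esub> y) z = ip V x z - ip V y z"
  by (simp add: a_minus_def)

lemma ip_minus_right [simp]: "\<lbrakk>x \<in> carrier V; y \<in> carrier V; z \<in> carrier V\<rbrakk>
    \<Longrightarrow> ip V z (x \<ominus>\<^bsub>V\<^esub> y) = ip V z x - ip V z y"
  using ip_cnj[of "x \<ominus>\<^bsub>V\<^esub> y" z] ip_cnj[of x z] ip_cnj[of y z] by simp

text \<open>
  Together with the formulas for inner products of sums and multiples, this reduces an equation
  between vectors to an identity between complex numbers.
\<close>

lemma ip_ext:
  assumes "x \<in> carrier V" "y \<in> carrier V" "\<And>z. z \<in> carrier V \<Longrightarrow> ip V x z = ip V y z"
  shows "x = y"
proof -
  have "ip V (x \<ominus>\<^bsub>V\<^esub> y) (x \<ominus>\<^bsub>V\<^esub> y) = 0"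
    using assms by simp
  then show ?thesis
    using assms ip_self_eq_0[of "x \<ominus>\<^bsub>V\<^esub> y"] by simp
qed

lemma ip_finsum_left [simp]:
  assumes "finite I" "\<forall>i\<in>I. f i \<in> carrier V" "z \<in> carrier V"
  shows "ip V (\<Oplus>\<^bsub>V\<^esub> i\<in>I. f i) z = (\<Sum>i\<in>I. ip V (f i) z)"
  using assms by (induction I rule: finite_induct) (auto simp: Pi_def)

lemma subspace_finsum:
  assumes "submodule class_ring W V" "finite I" "\<And>i. i \<in> I \<Longrightarrow> f i \<in> W"
  shows "(\<Oplus>\<^bsub>V\<^esub> i\<in>I. f i) \<in> W"
proof -
  have "W \<subseteq> carrier V" by (rule submodule.subset[OF assms(1)])
  then have "\<And>i. i \<in> I \<Longrightarrow> f i \<in> carrier V" using assms(3) by blast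
  with assms(2,3) show ?thesis
  proof (induction I rule: finite_induct)
    case empty
    then show ?case using submodule.zero_closed[OF assms(1)] by simp
  next
    case (insert i I)
    then show ?case
      using submodule.m_closed[OF assms(1)] by (subst finsum_insert) (auto simp: Pi_def)
  qed
qed

lemma subspace_smult:
  "submodule class_ring W V \<Longrightarrow> x \<in> W \<Longrightarrow> c \<odot>\<^bsub>V\<^esub> x \<in> W"
  using submodule.smult_closed[of class_ring W V c x] by simp

lemma subspace_minus:
  assumes "submodule class_ring W V" "x \<in> W" "y \<in> W"
  shows "x \<ominus>\<^bsub>V\<^esub> y \<in> W"
proof -
  have c: "x \<in> carrier V" "y \<in> carrier V"
    using assms submodule.subset[OF assms(1)] by auto
  have "x \<ominus>\<^bsub>V\<^esub> y = x \<oplus>\<^bsub>V\<^esub> (-1) \<odot>\<^bsub>V\<^esub> y"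
    using c by (intro ip_ext) auto
  then show ?thesis
    using assms submodule.m_closed[OF assms(1)] subspace_smult[OF assms(1)] by simp
qed

lemma submoduleI:
  assumes "W \<subseteq> carrier V" "\<zero>\<^bsub>V\<^esub> \<in> W"
    "\<And>x y. x \<in> W \<Longrightarrow> y \<in> W \<Longrightarrow> x \<oplus>\<^bsub>V\<^esub> y \<in> W"
    "\<And>c x. x \<in> W \<Longrightarrow> c \<odot>\<^bsub>V\<^esub> x \<in> W"
  shows "submodule class_ring W V"
  using assms module_axioms by (auto simp: submodule_def)

lemma span_minimal: "S \<subseteq> W \<Longrightarrow> submodule class_ring W V \<Longrightarrow> span S \<subseteq> W"
  by (rule span_is_subset)

section \<open>Orthonormal families\<close>

text \<open>
  Lists, because Gram--Schmidt depends on the order and the basis of the problem is addressed by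
  index.
\<close>

definition orthonormal :: "'v list \<Rightarrow> bool" where
  "orthonormal gs \<longleftrightarrow> set gs \<subseteq> carrier V \<and>
     (\<forall>i<length gs. \<forall>j<length gs. ip V (gs ! i) (gs ! j) = (if i = j then 1 else 0))"

text \<open>
  For orthonormal \<open>gs\<close> this is the orthogonal projection onto the span; for every list it is the
  vector that a Gram--Schmidt step subtracts from \<open>x\<close>.
\<close>

definition proj :: "'v list \<Rightarrow> 'v \<Rightarrow> 'v" where
  "proj gs x = (\<Oplus>\<^bsub>V\<^esub> i\<in>{..<length gs}. ip V x (gs ! i) \<odot>\<^bsub>V\<^esub> gs ! i)"

lemma nth_in_carrier [simp]: "set gs \<subseteq> carrier V \<Longrightarrow> i < length gs \<Longrightarrow> gs ! i \<in> carrier V"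
  by (meson nth_mem subsetD)

lemma proj_closed [simp]: "set gs \<subseteq> carrier V \<Longrightarrow> proj gs x \<in> carrier V"
  by (simp add: proj_def)

lemma ip_proj: "set gs \<subseteq> carrier V \<Longrightarrow> y \<in> carrier V \<Longrightarrow>
    ip V (proj gs x) y = (\<Sum>i<length gs. ip V x (gs ! i) * ip V (gs ! i) y)"
  by (simp add: proj_def)

lemma orthonormal_carrier: "orthonormal gs \<Longrightarrow> set gs \<subseteq> carrier V"
  by (simp add: orthonormal_def)

lemma orthonormal_ip: "orthonormal gs \<Longrightarrow> i < length gs \<Longrightarrow> j < length gs \<Longrightarrow>
    ip V (gs ! i) (gs ! j) = (if i = j then 1 else 0)"
  by (simp add: orthonormal_def)

lemma ip_proj_nth:
  assumes "orthonormal gs" "j < length gs" "x \<in> carrier V"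
  shows "ip V (proj gs x) (gs ! j) = ip V x (gs ! j)"
  using assms by (simp add: ip_proj orthonormal_carrier orthonormal_ip if_distrib cong: if_cong)

lemma proj_add: "set gs \<subseteq> carrier V \<Longrightarrow> x \<in> carrier V \<Longrightarrow> y \<in> carrier V \<Longrightarrow>
    proj gs (x \<oplus>\<^bsub>V\<^esub> y) = proj gs x \<oplus>\<^bsub>V\<^esub> proj gs y"
  by (rule ip_ext) (simp_all add: ip_proj sum.distrib algebra_simps)

lemma proj_smult: "set gs \<subseteq> carrier V \<Longrightarrow> x \<in> carrier V \<Longrightarrow>
    proj gs (c \<odot>\<^bsub>V\<^esub> x) = c \<odot>\<^bsub>V\<^esub> proj gs x"
  by (rule ip_ext) (simp_all add: ip_proj sum_distrib_left algebra_simps)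

lemma proj_in_span: "set gs \<subseteq> carrier V \<Longrightarrow> proj gs x \<in> span (set gs)"
  unfolding proj_def
  by (rule subspace_finsum)
     (use in_own_span[of "set gs"] in \<open>auto intro!: span_is_submodule subspace_smult\<close>)

lemma proj_nth:
  assumes "orthonormal gs" "i < length gs"
  shows "proj gs (gs ! i) = gs ! i"
proof (rule ip_ext)
  fix z assume "z \<in> carrier V"
  then show "ip V (proj gs (gs ! i)) z = ip V (gs ! i) z"
    using assms by (simp add: ip_proj orthonormal_carrier orthonormal_ip if_distrib[of "\<lambda>x. x * _"] cong: if_cong)
qed (use assms orthonormal_carrier in auto)

text \<open>
  The vectors fixed by \<^term>\<open>proj gs\<close> form a subspace that contains the generators; conversely, a
  value of \<^term>\<open>proj gs\<close> is a linear combination of them.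
\<close>

lemma in_span_orthonormal_iff:
  assumes "orthonormal gs"
  shows "x \<in> span (set gs) \<longleftrightarrow> x \<in> carrier V \<and> proj gs x = x"
proof -
  note [simp] = orthonormal_carrier[OF assms]
  have "submodule class_ring {x \<in> carrier V. proj gs x = x} V"
    by (rule submoduleI) (auto simp: proj_add proj_smult intro: ip_ext simp: ip_proj)
  moreover have "set gs \<subseteq> {x \<in> carrier V. proj gs x = x}"
    using proj_nth[OF assms] by (auto simp: in_set_conv_nth)
  ultimately have "span (set gs) \<subseteq> {x \<in> carrier V. proj gs x = x}"
    by (intro span_minimal)
  then show ?thesis
    using proj_in_span[of gs x] by auto
qed

lemma parseval:
  assumes "orthonormal gs" "x \<in> span (set gs)" "y \<in> carrier V"
  shows "ip V x y = (\<Sum>i<length gs. ip V x (gs ! i) * cnj (ip V y (gs ! i)))"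
proof -
  have x: "x \<in> carrier V" "proj gs x = x"
    using assms by (auto simp: in_span_orthonormal_iff)
  have "ip V x y = (\<Sum>i<length gs. ip V x (gs ! i) * ip V (gs ! i) y)"
    using ip_proj[of gs y x] assms x by (simp add: orthonormal_carrier)
  also have "\<dots> = (\<Sum>i<length gs. ip V x (gs ! i) * cnj (ip V y (gs ! i)))"
    using assms by (intro sum.cong) (auto simp: ip_cnj[of y] orthonormal_carrier)
  finally show ?thesis .
qed

lemma orthonormal_ext:
  assumes "orthonormal gs" "x \<in> span (set gs)" "y \<in> span (set gs)"
    "\<And>i. i < length gs \<Longrightarrow> ip V x (gs ! i) = ip V y (gs ! i)"
  shows "x = y"
proof -
  have "proj gs x = proj gs y"
    unfolding proj_def using assms
    by (intro finsum_cong') (auto simp: orthonormal_carrier)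
  then show ?thesis using assms by (simp add: in_span_orthonormal_iff)
qed

lemma orthonormal_distinct: "orthonormal gs \<Longrightarrow> distinct gs"
  unfolding distinct_conv_nth using orthonormal_ip by (metis zero_neq_one)

lemma orthonormal_take_drop:
  assumes "orthonormal (gs @ hs)"
  shows "orthonormal gs" "orthonormal hs"
    "i < length gs \<Longrightarrow> j < length hs \<Longrightarrow> ip V (gs ! i) (hs ! j) = 0"
    "i < length gs \<Longrightarrow> j < length hs \<Longrightarrow> ip V (hs ! j) (gs ! i) = 0"
proof -
  have c: "set gs \<subseteq> carrier V" "set hs \<subseteq> carrier V"
    using orthonormal_carrier[OF assms] by auto
  show "orthonormal gs"
    unfolding orthonormal_def
  proof (intro conjI allI impI c)
    fix i j assume "i < length gs" "j < length gs"
    then show "ip V (gs ! i) (gs ! j) = (if i = j then 1 else 0)"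
      using orthonormal_ip[OF assms, of i j] by (simp add: nth_append)
  qed
  show "orthonormal hs"
    unfolding orthonormal_def
  proof (intro conjI allI impI c)
    fix i j assume "i < length hs" "j < length hs"
    then show "ip V (hs ! i) (hs ! j) = (if i = j then 1 else 0)"
      using orthonormal_ip[OF assms, of "length gs + i" "length gs + j"] by simp
  qed
  show "ip V (gs ! i) (hs ! j) = 0" if "i < length gs" "j < length hs"
    using orthonormal_ip[OF assms, of i "length gs + j"] that by (simp add: nth_append)
  show "ip V (hs ! j) (gs ! i) = 0" if "i < length gs" "j < length hs"
    using orthonormal_ip[OF assms, of "length gs + j" i] that by (simp add: nth_append)
qed

lemma orthonormal_lin_indpt:
  assumes "orthonormal gs"
  shows "lin_indpt (set gs)"
proof (rule finite_lin_indpt2)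
  show "set gs \<subseteq> carrier V" by (rule orthonormal_carrier[OF assms])
  fix a :: "'v \<Rightarrow> complex"
  assume 0: "lincomb a (set gs) = \<zero>\<^bsub>V\<^esub>"
  show "\<forall>v\<in>set gs. a v = \<zero>\<^bsub>class_ring\<^esub>"
  proof
    fix v assume "v \<in> set gs"
    then obtain j where j: "j < length gs" "v = gs ! j" by (auto simp: in_set_conv_nth)
    have inj: "inj_on ((!) gs) {..<length gs}"
      using orthonormal_distinct[OF assms] by (simp add: inj_on_def nth_eq_iff_index_eq)
    have "0 = ip V (lincomb a (set gs)) v"
      using 0 j orthonormal_carrier[OF assms] by simp
    also have "\<dots> = (\<Sum>u\<in>set gs. a u * ip V u v)"
      unfolding lincomb_def using j orthonormal_carrier[OF assms]
      by (subst ip_finsum_left) (auto intro!: sum.cong ip_smult_left)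
    also have "set gs = (!) gs ` {..<length gs}"
      by (auto simp: set_conv_nth)
    also have "(\<Sum>u\<in>(!) gs ` {..<length gs}. a u * ip V u v)
        = (\<Sum>i<length gs. a (gs ! i) * ip V (gs ! i) v)"
      using inj by (simp add: sum.reindex)
    also have "\<dots> = a v"
      using j by (simp add: orthonormal_ip[OF assms] if_distrib cong: if_cong)
    finally show "a v = \<zero>\<^bsub>class_ring\<^esub>" by simp
  qed
qed simp

lemma subdim_span_orthonormal:
  assumes "orthonormal gs"
  shows "subdim V (span (set gs)) = length gs"
proof -
  have c: "set gs \<subseteq> carrier V" by (rule orthonormal_carrier[OF assms])
  have sub: "submodule class_ring (span (set gs)) V"
    by (rule span_is_submodule[OF c])
  have "subspace class_ring (span (set gs)) V"
    using sub vectorspace_axioms by (simp add: subspace_def)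
  then interpret W: vectorspace "class_ring :: complex ring" "V\<lparr>carrier := span (set gs)\<rparr>"
    by (rule subspace_is_vs)
  have "W.basis (set gs)"
    unfolding W.basis_def
    using span_li_not_depend[OF in_own_span[OF c] sub] orthonormal_lin_indpt[OF assms]
      in_own_span[OF c] by simp
  then have "W.dim = card (set gs)"
    by (intro W.dim_basis) simp_all
  then show ?thesis
    using orthonormal_distinct[OF assms] by (simp add: distinct_card)
qed

text \<open>
  A vector orthogonal to \<open>gs\<close> has nonzero coefficients only along \<open>hs\<close>. Hence the index of
  nonself-adjointness counts the basis elements that follow those of \<open>H\<^sub>0\<close>.
\<close>

lemma orth_compl_orthonormal:
  assumes "orthonormal (gs @ hs)" "span (set (gs @ hs)) = carrier V"
  shows "orth_compl V (span (set gs)) = span (set hs)"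
proof (rule Set.set_eqI)
  fix x
  note o = orthonormal_take_drop[OF assms(1)]
  note c = orthonormal_carrier[OF o(1)] orthonormal_carrier[OF o(2)]
  show "x \<in> orth_compl V (span (set gs)) \<longleftrightarrow> x \<in> span (set hs)"
  proof
    assume "x \<in> orth_compl V (span (set gs))"
    then have x: "x \<in> carrier V" "\<And>y. y \<in> span (set gs) \<Longrightarrow> ip V x y = 0"
      by (auto simp: orth_compl_def)
    then have 0: "ip V x (gs ! i) = 0" if "i < length gs" for i
      using that in_own_span[OF c(1)] by (meson nth_mem subsetD)
    have "proj hs x = x"
    proof (rule orthonormal_ext[OF assms(1)])
      fix i assume i: "i < length (gs @ hs)"
      show "ip V (proj hs x) ((gs @ hs) ! i) = ip V x ((gs @ hs) ! i)"
      proof (cases "i < length gs")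
        case True
        then show ?thesis
          using 0 o(4) c by (simp add: nth_append ip_proj)
      next
        case False
        then show ?thesis
          using i ip_proj_nth[OF o(2), of "i - length gs" x] x by (simp add: nth_append)
      qed
    qed (use assms x c in auto)
    then show "x \<in> span (set hs)"
      using in_span_orthonormal_iff[OF o(2)] x by auto
  next
    assume x: "x \<in> span (set hs)"
    have "ip V x y = 0" if y: "y \<in> span (set gs)" for y
    proof -
      have y': "y \<in> carrier V" "proj gs y = y" using y in_span_orthonormal_iff[OF o(1)] by auto
      have "ip V (gs ! i) x = 0" if "i < length gs" for i
        using parseval[OF o(2) x, of "gs ! i"] that o(3) c in_span_orthonormal_iff[OF o(2)] x
        by (simp add: ip_cnj[of x "gs ! i"])
      then have "ip V y x = 0"
        using parseval[OF o(1) y, of x] in_span_orthonormal_iff[OF o(2)] x c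
        by (simp add: ip_cnj[of _ x])
      then show ?thesis
        using ip_cnj[of y x] y' in_span_orthonormal_iff[OF o(2)] x by simp
    qed
    then show "x \<in> orth_compl V (span (set gs))"
      using x in_span_orthonormal_iff[OF o(2)] by (auto simp: orth_compl_def)
  qed
qed

section \<open>Gram--Schmidt orthonormalization\<close>

lemma gram_schmidt_step_eq:
  "gram_schmidt_step V gs v =
     (let w = v \<ominus>\<^bsub>V\<^esub> proj gs v in
      if w = \<zero>\<^bsub>V\<^esub> then gs else gs @ [complex_of_real (1 / ip_norm V w) \<odot>\<^bsub>V\<^esub> w])"
  by (simp add: gram_schmidt_step_def proj_def)

text \<open>
  The residual of \<open>v\<close> is orthogonal to \<open>gs\<close>. If it vanishes, \<open>v\<close> already lies in the span of \<open>gs\<close>;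
  otherwise \<open>v\<close> and the normalized residual are combinations of each other modulo that span.
\<close>

lemma gram_schmidt_step:
  assumes "orthonormal gs" "v \<in> carrier V"
  shows "orthonormal (gram_schmidt_step V gs v)"
    and "span (set (gram_schmidt_step V gs v)) = span (insert v (set gs))"
    and "gram_schmidt_step V gs v = gs \<or> (\<exists>u. gram_schmidt_step V gs v = gs @ [u])"
proof -
  define w where "w = v \<ominus>\<^bsub>V\<^esub> proj gs v"
  define u where "u = complex_of_real (1 / ip_norm V w) \<odot>\<^bsub>V\<^esub> w"
  note c = orthonormal_carrier[OF assms(1)]
  have st: "gram_schmidt_step V gs v = (if w = \<zero>\<^bsub>V\<^esub> then gs else gs @ [u])"
    by (simp add: gram_schmidt_step_eq w_def u_def Let_def)
  show "gram_schmidt_step V gs v = gs \<or> (\<exists>u. gram_schmidt_step V gs v = gs @ [u])"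
    by (simp add: st)
  have wc: "w \<in> carrier V" using c assms by (simp add: w_def minus_closed)
  then have uc: "u \<in> carrier V" by (simp add: u_def)
  have wg: "ip V w (gs ! i) = 0" if "i < length gs" for i
    using that c assms ip_proj_nth[OF assms(1)] by (simp add: w_def)
  have wg': "ip V (gs ! i) w = 0" if "i < length gs" for i
    using that wg[OF that] ip_cnj[of w "gs ! i"] c wc by simp
  have uu: "ip V u u = 1" if "w \<noteq> \<zero>\<^bsub>V\<^esub>"
  proof -
    have p: "0 < Re (ip V w w)" using ip_pos[OF wc that] .
    have "ip V w w = complex_of_real ((ip_norm V w)\<^sup>2)"
      using p ip_self_real[OF wc] by (simp add: ip_norm_def)
    moreover have "ip_norm V w \<noteq> 0" using p by (simp add: ip_norm_def)
    ultimately show ?thesis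
      using wc by (simp add: u_def power2_eq_square)
  qed
  show "orthonormal (gram_schmidt_step V gs v)"
    unfolding st
  proof (split if_split, intro conjI impI)
    assume ne: "w \<noteq> \<zero>\<^bsub>V\<^esub>"
    have "ip V ((gs @ [u]) ! i) ((gs @ [u]) ! j) = (if i = j then 1 else 0)"
      if "i < Suc (length gs)" "j < Suc (length gs)" for i j
      using that uu[OF ne] orthonormal_ip[OF assms(1), of i j] wg wg' wc c
      by (auto simp: nth_append u_def less_Suc_eq)
    then show "orthonormal (gs @ [u])"
      using c uc by (simp add: orthonormal_def)
  qed (rule assms(1))
  have ins: "insert v (set gs) \<subseteq> carrier V" using c assms by auto
  have mono: "span (set gs) \<subseteq> span (insert v (set gs))"
    by (rule span_is_monotone) auto
  have pv: "proj gs v \<in> span (insert v (set gs))"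
    using proj_in_span[OF c] mono by auto
  have vv: "v \<in> span (insert v (set gs))" using in_own_span[OF ins] by auto
  have ys: "w \<in> span (insert v (set gs))"
    unfolding w_def by (rule subspace_minus[OF span_is_submodule[OF ins] vv pv])
  have gsub: "set gs \<subseteq> span (insert v (set gs))" using in_own_span[OF ins] by auto
  show "span (set (gram_schmidt_step V gs v)) = span (insert v (set gs))"
  proof (cases "w = \<zero>\<^bsub>V\<^esub>")
    case True
    then have "v = proj gs v"
      using assms c unfolding w_def by simp
    then have "v \<in> span (set gs)" using proj_in_span[OF c] by metis
    then have "span (insert v (set gs)) \<subseteq> span (set gs)"
      using in_own_span[OF c] by (intro span_minimal span_is_submodule c) auto
    then show ?thesis using mono by (simp add: st True)
  next
    case False
    have ins': "set (gs @ [u]) \<subseteq> carrier V" using c uc by simp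
    have "u \<in> span (insert v (set gs))"
      unfolding u_def by (rule subspace_smult[OF span_is_submodule[OF ins] ys])
    then have 1: "span (set (gs @ [u])) \<subseteq> span (insert v (set gs))"
      using gsub by (intro span_minimal span_is_submodule ins) auto
    have m: "span (set gs) \<subseteq> span (set (gs @ [u]))"
      by (rule span_is_monotone) auto
    have "0 < Re (ip V w w)" using ip_pos[OF wc False] .
    then have "ip_norm V w \<noteq> 0" by (simp add: ip_norm_def)
    then have "w = complex_of_real (ip_norm V w) \<odot>\<^bsub>V\<^esub> u"
      using wc uc by (intro ip_ext) (auto simp: u_def)
    moreover have us: "u \<in> span (set (gs @ [u]))"
      using in_own_span[OF ins'] by auto
    ultimately have w2: "w \<in> span (set (gs @ [u]))"
      using subspace_smult[OF span_is_submodule[OF ins'] us] by metis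
    have "v = w \<oplus>\<^bsub>V\<^esub> proj gs v"
      using wc c assms by (intro ip_ext) (auto simp: w_def)
    moreover have "w \<oplus>\<^bsub>V\<^esub> proj gs v \<in> span (set (gs @ [u]))"
      using submodule.m_closed[OF span_is_submodule[OF ins'] w2] m proj_in_span[OF c, of v]
      by blast
    ultimately have "v \<in> span (set (gs @ [u]))"
      by (rule ssubst)
    then have "span (insert v (set gs)) \<subseteq> span (set (gs @ [u]))"
      using in_own_span[OF ins'] by (intro span_minimal span_is_submodule ins') auto
    then show ?thesis using 1 by (simp add: st False)
  qed
qed

lemma gram_schmidt_basis_snoc:
  "gram_schmidt_basis V (xs @ [v]) = gram_schmidt_step V (gram_schmidt_basis V xs) v"
  by (simp add: gram_schmidt_basis_def)

lemma span_insert_cong: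
  assumes "v \<in> carrier V" "A \<subseteq> carrier V" "B \<subseteq> carrier V" "span A = span B"
  shows "span (insert v A) = span (insert v B)"
proof -
  have *: "span (insert v A) \<subseteq> span (insert v B)"
    if "A \<subseteq> carrier V" "B \<subseteq> carrier V" "span A = span B" for A B
  proof (rule span_minimal)
    show "submodule class_ring (span (insert v B)) V"
      using that assms by (intro span_is_submodule) auto
    have "A \<subseteq> span (insert v B)"
      using in_own_span[OF that(1)] span_is_monotone[of B "insert v B"] that by blast
    moreover have "v \<in> span (insert v B)"
      using in_own_span[of "insert v B"] that assms by auto
    ultimately show "insert v A \<subseteq> span (insert v B)" by simp
  qed
  show ?thesis
    using *[of A B] *[of B A] assms by simp
qed

lemma gram_schmidt_basis:
  assumes "set xs \<subseteq> carrier V"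
  shows "orthonormal (gram_schmidt_basis V xs)"
    and "span (set (gram_schmidt_basis V xs)) = span (set xs)"
proof -
  have "orthonormal (gram_schmidt_basis V xs)
      \<and> span (set (gram_schmidt_basis V xs)) = span (set xs)"
    using assms
  proof (induction xs rule: rev_induct)
    case Nil
    then show ?case by (simp add: gram_schmidt_basis_def orthonormal_def)
  next
    case (snoc v xs)
    then have IH: "orthonormal (gram_schmidt_basis V xs)"
      "span (set (gram_schmidt_basis V xs)) = span (set xs)" and v: "v \<in> carrier V" by auto
    show ?case
      using gram_schmidt_step[OF IH(1) v]
        span_insert_cong[OF v orthonormal_carrier[OF IH(1)] _ IH(2)] snoc.prems
      by (simp add: gram_schmidt_basis_snoc)
  qed
  then show "orthonormal (gram_schmidt_basis V xs)"
    "span (set (gram_schmidt_basis V xs)) = span (set xs)" by auto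
qed

text \<open>
  Steps only append. Hence the list obtained from the monomials of degree below \<open>r\<close> starts the
  list obtained from all monomials.
\<close>

lemma gram_schmidt_basis_append:
  assumes "set (xs @ ys) \<subseteq> carrier V"
  shows "\<exists>hs. gram_schmidt_basis V (xs @ ys) = gram_schmidt_basis V xs @ hs"
  using assms
proof (induction ys rule: rev_induct)
  case Nil
  then show ?case by simp
next
  case (snoc w ys)
  then obtain hs where "gram_schmidt_basis V (xs @ ys) = gram_schmidt_basis V xs @ hs"
    by auto
  moreover have "orthonormal (gram_schmidt_basis V (xs @ ys))"
    using snoc.prems by (intro gram_schmidt_basis) auto
  ultimately show ?case
    using gram_schmidt_step(3)[of "gram_schmidt_basis V (xs @ ys)" w] snoc.prems
    unfolding append_assoc[symmetric] gram_schmidt_basis_snoc by fastforce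
qed

text \<open>
  Every nonempty initial segment of the output was the whole output at some stage. So an operator
  that leaves invariant the spans of all initial segments of \<open>xs\<close> is triangular in the orthonormal
  basis too.
\<close>

lemma gram_schmidt_basis_flag:
  assumes "set xs \<subseteq> carrier V" "j < length (gram_schmidt_basis V xs)"
  shows "\<exists>i\<le>length xs. span (set (take (Suc j) (gram_schmidt_basis V xs))) = span (set (take i xs))"
  using assms
proof (induction xs rule: rev_induct)
  case Nil
  then show ?case by (simp add: gram_schmidt_basis_def)
next
  case (snoc v xs)
  let ?g = "gram_schmidt_basis V xs"
  have c: "set xs \<subseteq> carrier V" "v \<in> carrier V" using snoc.prems by auto
  show ?case
  proof (cases "j < length ?g")
    case True
    then obtain i where "i \<le> length xs" "span (set (take (Suc j) ?g)) = span (set (take i xs))"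
      using snoc.IH c by auto
    moreover have "take (Suc j) (gram_schmidt_basis V (xs @ [v])) = take (Suc j) ?g"
      using gram_schmidt_step(3)[OF gram_schmidt_basis(1)[OF c(1)] c(2)] True
      by (auto simp: gram_schmidt_basis_snoc)
    ultimately show ?thesis by (intro exI[of _ i]) simp
  next
    case False
    then have "take (Suc j) (gram_schmidt_basis V (xs @ [v])) = gram_schmidt_basis V (xs @ [v])"
      using snoc.prems gram_schmidt_step(3)[OF gram_schmidt_basis(1)[OF c(1)] c(2)]
      by (auto simp: gram_schmidt_basis_snoc)
    then show ?thesis
      using gram_schmidt_basis(2)[OF snoc.prems(1)] by (intro exI[of _ "length (xs @ [v])"]) simp
  qed
qed

end

section \<open>The spectral theorem for a commuting pair\<close>

context ip_space
begin

lemma module_homI: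
  assumes "\<And>x. x \<in> carrier V \<Longrightarrow> T x \<in> carrier V"
    "\<And>x y. x \<in> carrier V \<Longrightarrow> y \<in> carrier V \<Longrightarrow> T (x \<oplus>\<^bsub>V\<^esub> y) = T x \<oplus>\<^bsub>V\<^esub> T y"
    "\<And>c x. x \<in> carrier V \<Longrightarrow> T (c \<odot>\<^bsub>V\<^esub> x) = c \<odot>\<^bsub>V\<^esub> T x"
  shows "T \<in> module_hom class_ring V V"
  using assms by (auto simp: module_hom_def)

lemma
  assumes "T \<in> module_hom class_ring V V"
  shows hom_closed: "x \<in> carrier V \<Longrightarrow> T x \<in> carrier V"
    and hom_add: "x \<in> carrier V \<Longrightarrow> y \<in> carrier V \<Longrightarrow> T (x \<oplus>\<^bsub>V\<^esub> y) = T x \<oplus>\<^bsub>V\<^esub> T y"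
    and hom_smult: "x \<in> carrier V \<Longrightarrow> T (c \<odot>\<^bsub>V\<^esub> x) = c \<odot>\<^bsub>V\<^esub> T x"
  using assms by (auto simp: module_hom_def Pi_def)

lemma hom_finsum:
  assumes "T \<in> module_hom class_ring V V" "finite I" "\<And>i. i \<in> I \<Longrightarrow> f i \<in> carrier V"
  shows "T (\<Oplus>\<^bsub>V\<^esub> i\<in>I. f i) = (\<Oplus>\<^bsub>V\<^esub> i\<in>I. T (f i))"
  using assms(2,3)
proof (induction I rule: finite_induct)
  case empty
  have "T \<zero>\<^bsub>V\<^esub> = T (0 \<odot>\<^bsub>V\<^esub> \<zero>\<^bsub>V\<^esub>)" by simp
  also have "\<dots> = \<zero>\<^bsub>V\<^esub>"
    by (subst hom_smult[OF assms(1)]) (auto intro!: ip_ext simp: hom_closed[OF assms(1)])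
  finally show ?case by simp
next
  case (insert i I)
  then show ?case
    using hom_closed[OF assms(1)] by (simp add: Pi_def hom_add[OF assms(1)])
qed

lemma self_adjoint_hom: "self_adjoint_op V T \<Longrightarrow> T \<in> module_hom class_ring V V"
  by (simp add: self_adjoint_op_def)

lemma self_adjoint_ip: "self_adjoint_op V T \<Longrightarrow> x \<in> carrier V \<Longrightarrow> y \<in> carrier V \<Longrightarrow>
    ip V (T x) y = ip V x (T y)"
  by (simp add: self_adjoint_op_def)

lemma hom_preserves_span:
  assumes "T \<in> module_hom class_ring V V" "A \<subseteq> carrier V" "submodule class_ring W V"
    "\<And>x. x \<in> A \<Longrightarrow> T x \<in> W" "x \<in> span A"
  shows "T x \<in> W"
proof -
  have "submodule class_ring {x \<in> carrier V. T x \<in> W} V"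
  proof (rule submoduleI)
    have "T \<zero>\<^bsub>V\<^esub> = \<zero>\<^bsub>V\<^esub>"
      using hom_finsum[OF assms(1), of "{}"] by simp
    then show "\<zero>\<^bsub>V\<^esub> \<in> {x \<in> carrier V. T x \<in> W}"
      using submodule.zero_closed[OF assms(3)] by simp
  qed (auto simp: hom_add[OF assms(1)] hom_smult[OF assms(1)]
      intro: submodule.m_closed[OF assms(3)] subspace_smult[OF assms(3)])
  then have "span A \<subseteq> {x \<in> carrier V. T x \<in> W}"
    using assms(2,4) by (intro span_minimal) auto
  then show ?thesis using assms(5) by auto
qed

text \<open>
  With the decomposition \<open>X P = P B\<close> of the matrix \<open>X\<close> of \<open>N\<close>, \<open>B\<close> upper triangular, the columns of
  \<open>P\<close> are coordinates of vectors with \<open>N p\<^sub>j = \<Sum>l\<le>j. B\<^sub>l\<^sub>j p\<^sub>l\<close>. The matrix \<open>P\<close> is invertible but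
  need not be unitary, so the \<open>p\<^sub>j\<close> need not be orthogonal; Gram--Schmidt repairs this in
  \<open>joint_eigenbasis\<close>.
\<close>

lemma triangular_generators:
  assumes N: "N \<in> module_hom class_ring V V"
    and on: "orthonormal gs" and full: "span (set gs) = carrier V"
  obtains ps where "set ps \<subseteq> carrier V" "span (set ps) = carrier V"
    "\<And>j. j < length ps \<Longrightarrow> N (ps ! j) \<in> span (set (take (Suc j) ps))"
proof -
  note c [simp] = orthonormal_carrier[OF on]
  define n where "n = length gs"
  define X where "X = Matrix.mat n n (\<lambda>(i, j). ip V (N (gs ! j)) (gs ! i))"
  have X: "X \<in> carrier_mat n n" by (simp add: X_def)
  obtain as where "char_poly X = (\<Prod>a\<leftarrow>as. [:- a, 1:])"
    using char_poly_factorized[OF X] by auto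
  moreover obtain B P Q where "schur_decomposition X as = (B, P, Q)"
    by (cases "schur_decomposition X as")
  ultimately have sim: "similar_mat_wit X B P Q" and ut: "upper_triangular B"
    using schur_decomposition[OF X] by blast+
  note w = similar_mat_witD2[OF X sim]
  have B: "B \<in> carrier_mat n n" and P: "P \<in> carrier_mat n n" and Q: "Q \<in> carrier_mat n n"
    using w by auto
  have XP: "X * P = P * B"
  proof -
    have "X * P = P * B * (Q * P)"
      using w B P Q by (simp add: assoc_mult_mat[of _ n n _ n _ n])
    then show ?thesis using w B P by simp
  qed
  define p where "p j = (\<Oplus>\<^bsub>V\<^esub> i\<in>{..<n}. P $$ (i, j) \<odot>\<^bsub>V\<^esub> gs ! i)" for j
  define ps where "ps = map p [0..<n]"
  have gc: "gs ! i \<in> carrier V" if "i < n" for i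
    using that by (simp add: n_def)
  have pc [simp]: "p j \<in> carrier V" for j
    by (simp add: p_def gc)
  have ip_p: "ip V (p j) (gs ! i) = P $$ (i, j)" if "i < n" for i j
    using that by (simp add: p_def gc orthonormal_ip[OF on] n_def[symmetric] if_distrib cong: if_cong)
  have eq: "x = y" if "x \<in> carrier V" "y \<in> carrier V"
    "\<And>i. i < n \<Longrightarrow> ip V x (gs ! i) = ip V y (gs ! i)" for x y
    using orthonormal_ext[OF on, of x y] that full n_def by simp
  have psc: "set ps \<subseteq> carrier V" by (auto simp: ps_def)
  have ps_span: "span (set ps) = carrier V"
  proof -
    have "gs ! m \<in> span (set ps)" if m: "m < n" for m
    proof -
      have "gs ! m = (\<Oplus>\<^bsub>V\<^esub> j\<in>{..<n}. Q $$ (j, m) \<odot>\<^bsub>V\<^esub> p j)"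
      proof (rule eq)
        fix i assume i: "i < n"
        have "(\<Sum>j<n. P $$ (i, j) * Q $$ (j, m)) = (P * Q) $$ (i, m)"
          using P Q i m by (simp add: scalar_prod_def lessThan_atLeast0)
        also have "\<dots> = (if i = m then 1 else 0)"
          using w i m by simp
        finally show "ip V (gs ! m) (gs ! i) = ip V (\<Oplus>\<^bsub>V\<^esub> j\<in>{..<n}. Q $$ (j, m) \<odot>\<^bsub>V\<^esub> p j) (gs ! i)"
          using i m orthonormal_ip[OF on, of m i] by (simp add: gc ip_p n_def[symmetric] mult.commute)
      qed (simp_all add: gc m)
      also have "\<dots> \<in> span (set ps)"
        by (rule subspace_finsum[OF span_is_submodule[OF psc]])
           (use in_own_span[OF psc] in \<open>auto simp: ps_def intro!: subspace_smult span_is_submodule psc[unfolded ps_def]\<close>)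
      finally show ?thesis .
    qed
    then have "span (set gs) \<subseteq> span (set ps)"
      by (intro span_minimal span_is_submodule psc) (auto simp: set_conv_nth n_def)
    then show ?thesis using full span_is_subset2[OF psc] by auto
  qed
  have inv: "N (ps ! j) \<in> span (set (take (Suc j) ps))" if "j < length ps" for j
  proof -
    have j: "j < n" using that by (simp add: ps_def)
    have st: "set (take (Suc j) ps) = p ` {..j}"
      using j by (simp add: ps_def take_map atLeastLessThanSuc_atLeastAtMost atMost_atLeast0 del: upt_Suc)
    have Nc: "N (gs ! l) \<in> carrier V" if "l < n" for l
      using that gc hom_closed[OF N] by simp
    have "N (p j) = (\<Oplus>\<^bsub>V\<^esub> l\<in>{..j}. B $$ (l, j) \<odot>\<^bsub>V\<^esub> p l)"
    proof (rule eq)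
      fix i assume i: "i < n"
      have "N (p j) = (\<Oplus>\<^bsub>V\<^esub> l\<in>{..<n}. N (P $$ (l, j) \<odot>\<^bsub>V\<^esub> gs ! l))"
        unfolding p_def by (rule hom_finsum[OF N]) (simp_all add: gc)
      also have "\<dots> = (\<Oplus>\<^bsub>V\<^esub> l\<in>{..<n}. P $$ (l, j) \<odot>\<^bsub>V\<^esub> N (gs ! l))"
        by (intro finsum_cong') (auto simp: gc Nc hom_smult[OF N])
      finally have "ip V (N (p j)) (gs ! i) = (\<Sum>l<n. P $$ (l, j) * ip V (N (gs ! l)) (gs ! i))"
        using i by (simp add: Nc gc)
      also have "\<dots> = (X * P) $$ (i, j)"
        using X P i j by (simp add: scalar_prod_def lessThan_atLeast0 X_def mult.commute)
      also have "\<dots> = (\<Sum>l<n. P $$ (i, l) * B $$ (l, j))"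
        using P B i j by (simp add: XP scalar_prod_def lessThan_atLeast0)
      also have "\<dots> = (\<Sum>l\<le>j. P $$ (i, l) * B $$ (l, j))"
      proof (rule sum.mono_neutral_right)
        show "\<forall>l\<in>{..<n} - {..j}. P $$ (i, l) * B $$ (l, j) = 0"
          using ut B j by (auto simp: upper_triangular_def)
      qed (use j in auto)
      also have "\<dots> = ip V (\<Oplus>\<^bsub>V\<^esub> l\<in>{..j}. B $$ (l, j) \<odot>\<^bsub>V\<^esub> p l) (gs ! i)"
        using i by (simp add: gc ip_p mult.commute)
      finally show "ip V (N (p j)) (gs ! i) = ip V (\<Oplus>\<^bsub>V\<^esub> l\<in>{..j}. B $$ (l, j) \<odot>\<^bsub>V\<^esub> p l) (gs ! i)" .
    qed (simp_all add: hom_closed[OF N])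
    also have "\<dots> \<in> span (p ` {..j})"
    proof -
      have pj: "p ` {..j} \<subseteq> carrier V" by auto
      have "p l \<in> span (p ` {..j})" if "l \<le> j" for l
        using in_own_span[OF pj] that by auto
      then show ?thesis
        by (intro subspace_finsum span_is_submodule[OF pj] subspace_smult) simp_all
    qed
    finally show ?thesis
      using st j by (simp add: ps_def)
  qed
  show ?thesis
    using that[OF psc ps_span inv] .
qed

text \<open>
  Induction along the basis. If the earlier basis vectors are eigenvectors of the adjoint \<open>N'\<close>, then
  \<open>N u\<^sub>j\<close> is orthogonal to them, and by triangularity only the coefficient along \<open>u\<^sub>j\<close> is left.
  Normality then gives \<open>\<parallel>N' u\<^sub>j - cnj l u\<^sub>j\<parallel> = \<parallel>N u\<^sub>j - l u\<^sub>j\<parallel> = 0\<close>.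
\<close>

lemma normal_triangular_imp_diagonal:
  assumes N: "N \<in> module_hom class_ring V V" and N': "N' \<in> module_hom class_ring V V"
    and adj: "\<And>x y. x \<in> carrier V \<Longrightarrow> y \<in> carrier V \<Longrightarrow> ip V (N x) y = ip V x (N' y)"
    and comm: "\<And>x. x \<in> carrier V \<Longrightarrow> N (N' x) = N' (N x)"
    and on: "orthonormal us" and full: "span (set us) = carrier V"
    and tri: "\<And>j. j < length us \<Longrightarrow> N (us ! j) \<in> span (set (take (Suc j) us))"
    and j: "j < length us"
  shows "N (us ! j) = ip V (N (us ! j)) (us ! j) \<odot>\<^bsub>V\<^esub> us ! j"
    and "N' (us ! j) = cnj (ip V (N (us ! j)) (us ! j)) \<odot>\<^bsub>V\<^esub> us ! j"
proof -
  note c [simp] = orthonormal_carrier[OF on]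
  note [simp] = hom_closed[OF N] hom_closed[OF N']
  have "N (us ! j) = ip V (N (us ! j)) (us ! j) \<odot>\<^bsub>V\<^esub> us ! j
      \<and> N' (us ! j) = cnj (ip V (N (us ! j)) (us ! j)) \<odot>\<^bsub>V\<^esub> us ! j"
    using j
  proof (induction j rule: less_induct)
    case (less j)
    let ?u = "us ! j"
    define l where "l = ip V (N ?u) ?u"
    have uc [simp]: "?u \<in> carrier V" using less.prems by simp
    have uu: "ip V ?u ?u = 1" using orthonormal_ip[OF on less.prems less.prems] by simp
    have N1: "N ?u = l \<odot>\<^bsub>V\<^esub> ?u"
    proof (rule orthonormal_ext[OF on])
      fix i assume i: "i < length us"
      consider "i < j" | "i = j" | "j < i" by linarith
      then show "ip V (N ?u) (us ! i) = ip V (l \<odot>\<^bsub>V\<^esub> ?u) (us ! i)"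
      proof cases
        case 1
        have "ip V (N ?u) (us ! i) = ip V ?u (N' (us ! i))"
          using i by (simp add: adj)
        also have "\<dots> = ip V ?u (cnj (ip V (N (us ! i)) (us ! i)) \<odot>\<^bsub>V\<^esub> us ! i)"
          using less.IH[OF 1 i] by simp
        also have "\<dots> = 0"
          using 1 i orthonormal_ip[OF on less.prems i] by simp
        finally show ?thesis
          using 1 i orthonormal_ip[OF on less.prems i] by simp
      next
        case 2
        then show ?thesis by (simp add: l_def uu)
      next
        case 3
        define ts where "ts = take (Suc j) us"
        have ap: "us = ts @ drop (Suc j) us" by (simp add: ts_def)
        have ts: "orthonormal ts" using on ap orthonormal_take_drop(1) by metis
        have "ip V (N ?u) (us ! i) = (\<Sum>m<length ts. ip V (N ?u) (ts ! m) * cnj (ip V (us ! i) (ts ! m)))"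
          using tri[OF less.prems] i by (intro parseval[OF ts]) (simp_all add: ts_def)
        also have "\<dots> = 0"
          using 3 i less.prems by (intro sum.neutral) (auto simp: ts_def orthonormal_ip[OF on])
        finally show ?thesis
          using 3 i orthonormal_ip[OF on less.prems i] by simp
      qed
    qed (simp_all add: full)
    have N'l: "ip V (N' x) y = ip V x (N y)" if "x \<in> carrier V" "y \<in> carrier V" for x y
      using adj[OF that(2,1)] ip_cnj[of "N y" x] ip_cnj[of y "N' x"] that by simp
    define w where "w = N' ?u \<ominus>\<^bsub>V\<^esub> cnj l \<odot>\<^bsub>V\<^esub> ?u"
    have 1: "ip V (N' ?u) ?u = cnj l" by (simp add: N'l N1 uu)
    have 2: "ip V ?u (N' ?u) = l" using adj[of ?u ?u] by (simp add: l_def)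
    have "ip V (N' ?u) (N' ?u) = ip V ?u (N' (N ?u))"
      by (simp add: N'l comm)
    also have "\<dots> = cnj l * l"
      by (simp add: N1 hom_smult[OF N'] 2)
    finally have "ip V w w = 0"
      by (simp add: w_def 1 2 uu)
    then have "w = \<zero>\<^bsub>V\<^esub>"
      by (subst ip_self_eq_0[symmetric]) (simp_all add: w_def)
    then have "N' ?u = cnj l \<odot>\<^bsub>V\<^esub> ?u"
      by (simp add: w_def)
    with N1 show ?case by (simp add: l_def)
  qed
  then show "N (us ! j) = ip V (N (us ! j)) (us ! j) \<odot>\<^bsub>V\<^esub> us ! j"
    "N' (us ! j) = cnj (ip V (N (us ! j)) (us ! j)) \<odot>\<^bsub>V\<^esub> us ! j"
    by auto
qed

text \<open>
  The operator \<open>N = T\<^sub>1 + \<i> T\<^sub>2\<close> is normal because \<open>T\<^sub>1\<close> and \<open>T\<^sub>2\<close> commute, and an orthonormal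
  eigenbasis of \<open>N\<close> and its adjoint diagonalizes both: the real and imaginary parts of the
  eigenvalues of \<open>N\<close> are the eigenvalues of \<open>T\<^sub>1\<close> and \<open>T\<^sub>2\<close>.
\<close>

theorem joint_eigenbasis:
  assumes T1: "self_adjoint_op V T1" and T2: "self_adjoint_op V T2"
    and comm: "commuting_ops V T1 T2"
    and on: "orthonormal gs" and full: "span (set gs) = carrier V"
  obtains us a b where "orthonormal us" "span (set us) = carrier V"
    "\<And>j. j < length us \<Longrightarrow> T1 (us ! j) = complex_of_real (a j) \<odot>\<^bsub>V\<^esub> us ! j"
    "\<And>j. j < length us \<Longrightarrow> T2 (us ! j) = complex_of_real (b j) \<odot>\<^bsub>V\<^esub> us ! j"
proof -
  note h1 = self_adjoint_hom[OF T1] and h2 = self_adjoint_hom[OF T2]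
  note [simp] = hom_closed[OF h1] hom_closed[OF h2] hom_add[OF h1] hom_add[OF h2]
    hom_smult[OF h1] hom_smult[OF h2]
  define N where "N x = T1 x \<oplus>\<^bsub>V\<^esub> \<i> \<odot>\<^bsub>V\<^esub> T2 x" for x
  define N' where "N' x = T1 x \<oplus>\<^bsub>V\<^esub> (-\<i>) \<odot>\<^bsub>V\<^esub> T2 x" for x
  have cm: "T1 (T2 x) = T2 (T1 x)" if "x \<in> carrier V" for x
    using comm that by (simp add: commuting_ops_def)
  have N: "N \<in> module_hom class_ring V V" and N': "N' \<in> module_hom class_ring V V"
    by (rule module_homI; (simp add: N_def N'_def)?; intro ip_ext; simp add: algebra_simps)+
  have adj: "ip V (N x) y = ip V x (N' y)" if "x \<in> carrier V" "y \<in> carrier V" for x y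
    using that by (simp add: N_def N'_def self_adjoint_ip[OF T1] self_adjoint_ip[OF T2])
  have NN: "N (N' x) = N' (N x)" if "x \<in> carrier V" for x
    using that by (intro ip_ext) (simp_all add: N_def N'_def cm algebra_simps)
  obtain ps where ps: "set ps \<subseteq> carrier V" "span (set ps) = carrier V"
    and inv: "\<And>j. j < length ps \<Longrightarrow> N (ps ! j) \<in> span (set (take (Suc j) ps))"
    using triangular_generators[OF N on full] by blast
  define us where "us = gram_schmidt_basis V ps"
  have us: "orthonormal us" "span (set us) = carrier V"
    using gram_schmidt_basis[OF ps(1)] ps(2) by (simp_all add: us_def)
  have tk: "set (take i ps) \<subseteq> carrier V" for i
    using ps(1) set_take_subset by fast
  have inv': "N x \<in> span (set (take i ps))" if x: "x \<in> span (set (take i ps))" for i x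
  proof (rule hom_preserves_span[OF N tk span_is_submodule[OF tk] _ x])
    fix y assume "y \<in> set (take i ps)"
    then obtain m where m: "m < i" "m < length ps" "y = ps ! m"
      by (auto simp: in_set_conv_nth)
    have "span (set (take (Suc m) ps)) \<subseteq> span (set (take i ps))"
      using m by (intro span_is_monotone set_take_subset_set_take) simp
    then show "N y \<in> span (set (take i ps))"
      using inv[OF m(2)] m by auto
  qed
  have tri: "N (us ! j) \<in> span (set (take (Suc j) us))" if j: "j < length us" for j
  proof -
    obtain i where i: "span (set (take (Suc j) us)) = span (set (take i ps))"
      using gram_schmidt_basis_flag[OF ps(1)] j unfolding us_def by blast
    have "us ! j \<in> set (take (Suc j) us)"
      using j by (auto simp: in_set_conv_nth intro!: exI[of _ j])
    then have "us ! j \<in> span (set (take (Suc j) us))"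
      using in_own_span[of "set (take (Suc j) us)"] set_take_subset[of "Suc j" us]
        orthonormal_carrier[OF us(1)] by blast
    then show ?thesis using inv'[of "us ! j" i] i by simp
  qed
  define l where "l j = ip V (N (us ! j)) (us ! j)" for j
  have eig: "N (us ! j) = l j \<odot>\<^bsub>V\<^esub> us ! j" "N' (us ! j) = cnj (l j) \<odot>\<^bsub>V\<^esub> us ! j"
    if "j < length us" for j
    using normal_triangular_imp_diagonal[OF N N' adj NN us tri that] by (simp_all add: l_def)
  have T1e: "T1 x = (1/2) \<odot>\<^bsub>V\<^esub> (N x \<oplus>\<^bsub>V\<^esub> N' x)"
    and T2e: "T2 x = (1/(2*\<i>)) \<odot>\<^bsub>V\<^esub> (N x \<ominus>\<^bsub>V\<^esub> N' x)" if "x \<in> carrier V" for x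
    using that by (intro ip_ext; simp add: N_def N'_def field_simps)+
  have uc: "us ! j \<in> carrier V" if "j < length us" for j
    using orthonormal_carrier[OF us(1)] that by simp
  show ?thesis
  proof (rule that[OF us])
    fix j assume j: "j < length us"
    have "l j + cnj (l j) = 2 * complex_of_real (Re (l j))"
      by (simp add: complex_eq_iff)
    then show "T1 (us ! j) = complex_of_real (Re (l j)) \<odot>\<^bsub>V\<^esub> us ! j"
      using uc[OF j] unfolding T1e[OF uc[OF j]] eig[OF j]
      by (intro ip_ext) (simp_all add: distrib_right[symmetric])
    have "l j - cnj (l j) = 2 * \<i> * complex_of_real (Im (l j))"
      by (simp add: complex_eq_iff)
    then show "T2 (us ! j) = complex_of_real (Im (l j)) \<odot>\<^bsub>V\<^esub> us ! j"
      using uc[OF j] unfolding T2e[OF uc[OF j]] eig[OF j]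
      by (intro ip_ext) (simp_all add: left_diff_distrib[symmetric])
  qed
qed

end

section \<open>The spectral measure of a joint eigenbasis\<close>

text \<open>
  An image measure, so that the weights of indices with the same point add up.
\<close>

definition point_masses :: "nat \<Rightarrow> (nat \<Rightarrow> real) \<Rightarrow> (nat \<Rightarrow> real \<times> real) \<Rightarrow> (real \<times> real) measure" where
  "point_masses n w p = distr (point_measure {..<n} (\<lambda>i. ennreal (w i))) borel p"

lemma sets_point_masses [simp]: "sets (point_masses n w p) = sets borel"
  and space_point_masses [simp]: "space (point_masses n w p) = UNIV"
  by (simp_all add: point_masses_def)

lemma emeasure_point_masses:
  assumes "\<And>i. 0 \<le> w i" "A \<in> sets borel"
  shows "emeasure (point_masses n w p) A = ennreal (\<Sum>i | i < n \<and> p i \<in> A. w i)"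
proof -
  have "emeasure (point_masses n w p) A
      = emeasure (point_measure {..<n} (\<lambda>i. ennreal (w i))) (p -` A \<inter> {..<n})"
    using assms(2) by (simp add: point_masses_def emeasure_distr space_point_measure)
  also have "p -` A \<inter> {..<n} = {i. i < n \<and> p i \<in> A}" by auto
  also have "emeasure (point_measure {..<n} (\<lambda>i. ennreal (w i))) \<dots>
      = (\<Sum>i | i < n \<and> p i \<in> A. ennreal (w i))"
    by (subst emeasure_point_measure_finite) auto
  also have "\<dots> = ennreal (\<Sum>i | i < n \<and> p i \<in> A. w i)"
    using assms(1) by simp
  finally show ?thesis .
qed

lemma measure_point_masses:
  assumes "\<And>i. 0 \<le> w i" "A \<in> sets borel"
  shows "measure (point_masses n w p) A = (\<Sum>i | i < n \<and> p i \<in> A. w i)"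
  using assms by (simp add: measure_def emeasure_point_masses sum_nonneg)

lemma integral_point_masses:
  fixes f :: "real \<times> real \<Rightarrow> real"
  assumes "\<And>i. 0 \<le> w i" "f \<in> borel_measurable borel"
  shows "integrable (point_masses n w p) f"
    and "integral\<^sup>L (point_masses n w p) f = (\<Sum>i<n. w i * f (p i))"
proof -
  show "integrable (point_masses n w p) f"
    using assms(2) unfolding point_masses_def
    by (subst integrable_distr_eq) (auto intro!: integrable_point_measure_finite)
  have "integral\<^sup>L (point_masses n w p) f
      = integral\<^sup>L (point_measure {..<n} (\<lambda>i. ennreal (w i))) (\<lambda>i. f (p i))"
    unfolding point_masses_def by (subst integral_distr) (simp_all add: assms(2))
  also have "\<dots> = (\<Sum>i<n. w i * f (p i))"
    using assms(1) by (subst lebesgue_integral_point_measure_finite) auto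
  finally show "integral\<^sup>L (point_masses n w p) f = (\<Sum>i<n. w i * f (p i))" .
qed

context ip_space
begin

text \<open>
  Indexed by basis vectors and not by points, so that joint eigenvalues of higher multiplicity need
  no separate treatment.
\<close>

definition eigen_measure ::
    "'v list \<Rightarrow> (nat \<Rightarrow> real \<times> real) \<Rightarrow> (real \<times> real) set \<Rightarrow> 'v \<Rightarrow> 'v" where
  "eigen_measure us p \<delta> x =
     (\<Oplus>\<^bsub>V\<^esub> i\<in>{i. i < length us \<and> p i \<in> \<delta>}. ip V x (us ! i) \<odot>\<^bsub>V\<^esub> us ! i)"

lemma eigen_measure_closed [simp]:
  "set us \<subseteq> carrier V \<Longrightarrow> eigen_measure us p \<delta> x \<in> carrier V"
  by (simp add: eigen_measure_def)

lemma ip_eigen_measure: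
  "set us \<subseteq> carrier V \<Longrightarrow> y \<in> carrier V \<Longrightarrow> ip V (eigen_measure us p \<delta> x) y
    = (\<Sum>i | i < length us \<and> p i \<in> \<delta>. ip V x (us ! i) * ip V (us ! i) y)"
  by (simp add: eigen_measure_def)

lemma ip_eigen_measure_self:
  assumes "set us \<subseteq> carrier V" "x \<in> carrier V"
  shows "ip V (eigen_measure us p \<delta> x) x
    = complex_of_real (\<Sum>i | i < length us \<and> p i \<in> \<delta>. (cmod (ip V x (us ! i)))\<^sup>2)"
proof -
  have "ip V x (us ! i) * ip V (us ! i) x = complex_of_real ((cmod (ip V x (us ! i)))\<^sup>2)"
    if "i < length us" for i
    using assms that ip_cnj[of x "us ! i"] by (simp add: complex_norm_square[symmetric])
  then show ?thesis
    using assms by (simp add: ip_eigen_measure)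
qed

lemma ip_eigen_measure_nth:
  assumes "orthonormal us" "x \<in> carrier V" "j < length us"
  shows "ip V (eigen_measure us p \<delta> x) (us ! j) = (if p j \<in> \<delta> then ip V x (us ! j) else 0)"
  using assms orthonormal_carrier[OF assms(1)]
  by (simp add: ip_eigen_measure orthonormal_ip if_distrib cong: if_cong)

text \<open>
  \<open>E \<delta>\<close> keeps the coefficients whose point lies in \<open>\<delta>\<close> and deletes the others, so all properties
  are checked coefficient by coefficient. For countable additivity, at most one member of a disjoint
  family contains a given point.
\<close>

lemma spectral_measure_eigen_measure:
  assumes on: "orthonormal us" and full: "span (set us) = carrier V"
  shows "spectral_measure V (eigen_measure us p)"
proof -
  note c [simp] = orthonormal_carrier[OF on]
  let ?E = "eigen_measure us p"
  have proj: "orth_projection V (?E \<delta>)" for \<delta>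
  proof -
    have "?E \<delta> \<in> module_hom class_ring V V"
    proof (rule module_homI)
      fix x y assume "x \<in> carrier V" "y \<in> carrier V"
      then show "?E \<delta> (x \<oplus>\<^bsub>V\<^esub> y) = ?E \<delta> x \<oplus>\<^bsub>V\<^esub> ?E \<delta> y"
        by (intro ip_ext) (simp_all add: ip_eigen_measure sum.distrib algebra_simps)
    next
      fix a x assume "x \<in> carrier V"
      then show "?E \<delta> (a \<odot>\<^bsub>V\<^esub> x) = a \<odot>\<^bsub>V\<^esub> ?E \<delta> x"
        by (intro ip_ext) (simp_all add: ip_eigen_measure sum_distrib_left algebra_simps)
    qed simp
    moreover have "ip V (?E \<delta> x) y = ip V x (?E \<delta> y)" if "x \<in> carrier V" "y \<in> carrier V" for x y
    proof -
      have "ip V x (?E \<delta> y) = cnj (ip V (?E \<delta> y) x)"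
        using that by (intro ip_cnj) auto
      also have "\<dots> = (\<Sum>i | i < length us \<and> p i \<in> \<delta>. cnj (ip V y (us ! i)) * cnj (ip V (us ! i) x))"
        using that by (simp add: ip_eigen_measure)
      also have "\<dots> = ip V (?E \<delta> x) y"
        unfolding ip_eigen_measure[OF c that(2)]
        using that by (intro sum.cong refl) (simp add: ip_cnj[of y] ip_cnj[of _ x] mult.commute)
      finally show ?thesis ..
    qed
    moreover have "?E \<delta> (?E \<delta> x) = ?E \<delta> x" if "x \<in> carrier V" for x
      using that by (intro orthonormal_ext[OF on]) (auto simp: full ip_eigen_measure_nth[OF on])
    ultimately show ?thesis
      by (simp add: orth_projection_def self_adjoint_op_def)
  qed
  have univ: "?E UNIV x = x" if "x \<in> carrier V" for x
    using that by (intro orthonormal_ext[OF on]) (auto simp: full ip_eigen_measure_nth[OF on])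
  have add: "(\<lambda>i. ip V (?E (F i) x) y) sums ip V (?E (\<Union>i. F i) x) y"
    if F: "disjoint_family F" and xy: "x \<in> carrier V" "y \<in> carrier V"
    for F :: "nat \<Rightarrow> (real \<times> real) set" and x y
  proof -
    define z where "z j = ip V x (us ! j) * ip V (us ! j) y" for j
    have E: "ip V (?E \<delta> x) y = (\<Sum>j<length us. if p j \<in> \<delta> then z j else 0)" for \<delta>
    proof -
      have "ip V (?E \<delta> x) y = (\<Sum>j \<in> {j \<in> {..<length us}. p j \<in> \<delta>}. z j)"
        using xy by (simp add: ip_eigen_measure z_def)
      then show ?thesis by (simp only: sum.inter_filter[symmetric] finite_lessThan)
    qed
    have single: "(\<lambda>i. if p j \<in> F i then z j else 0) sums (if p j \<in> (\<Union>i. F i) then z j else 0)" for j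
    proof (cases "p j \<in> (\<Union>i. F i)")
      case True
      then obtain m where m: "p j \<in> F m" by auto
      then have "p j \<in> F i \<longleftrightarrow> i = m" for i
        using F by (auto simp: disjoint_family_on_def)
      then show ?thesis using True sums_single[of m "\<lambda>_. z j"] by simp
    next
      case False
      then show ?thesis by simp
    qed
    show ?thesis
      unfolding E by (intro sums_sum single)
  qed
  show ?thesis
    unfolding spectral_measure_def using proj univ add by blast
qed

lemma diagonal_measure_eigen_measure:
  assumes "orthonormal us" "x \<in> carrier V"
  shows "diagonal_measure V (eigen_measure us p) x
    = point_masses (length us) (\<lambda>i. (cmod (ip V x (us ! i)))\<^sup>2) p"
    (is "_ = ?M")
proof -
  note c = orthonormal_carrier[OF assms(1)]
  have "?M = measure_of (space ?M) (sets ?M) (emeasure ?M)"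
    by (rule measure_of_of_measure[symmetric])
  also have "\<dots> = measure_of UNIV (sets borel) (emeasure ?M)" by simp
  also have "\<dots> = diagonal_measure V (eigen_measure us p) x"
    unfolding diagonal_measure_def
  proof (rule measure_of_eq)
    fix A :: "(real \<times> real) set" assume "A \<in> sigma_sets UNIV (sets borel)"
    then have A: "A \<in> sets borel" using sets.sigma_sets_eq[of "borel :: (real \<times> real) measure"] by simp
    show "emeasure ?M A = ennreal (Re (ip V (eigen_measure us p A x) x))"
      using A c assms by (simp add: emeasure_point_masses ip_eigen_measure_self)
  qed simp
  finally show ?thesis ..
qed

text \<open>
  The quadratic form of \<open>T\<close> at \<open>x\<close> and the integral of \<open>f\<close> both equal
  \<open>\<Sum>i. f (p i) \<bar>\<langle>x, u\<^sub>i\<rangle>\<bar>\<^sup>2\<close>.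
\<close>

lemma spectral_integral_eigen_measure:
  fixes f :: "real \<times> real \<Rightarrow> real"
  assumes on: "orthonormal us" and full: "span (set us) = carrier V"
    and T: "self_adjoint_op V T"
    and eig: "\<And>j. j < length us \<Longrightarrow> T (us ! j) = complex_of_real (f (p j)) \<odot>\<^bsub>V\<^esub> us ! j"
    and f: "f \<in> borel_measurable borel"
  shows "spectral_integral V (eigen_measure us p) f T"
  unfolding spectral_integral_def
proof (intro ballI conjI)
  fix x assume x: "x \<in> carrier V"
  note c [simp] = orthonormal_carrier[OF on]
  have Tx: "T x \<in> carrier V" using hom_closed[OF self_adjoint_hom[OF T] x] .
  show "integrable (diagonal_measure V (eigen_measure us p) x) (\<lambda>t. (f t)\<^sup>2)"
    unfolding diagonal_measure_eigen_measure[OF on x]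
    by (rule integral_point_masses(1)) (use f in auto)
  have "ip V (T x) x = (\<Sum>i<length us. ip V (T x) (us ! i) * cnj (ip V x (us ! i)))"
    using x Tx by (intro parseval[OF on]) (simp_all add: full)
  also have "\<dots> = (\<Sum>i<length us. complex_of_real ((cmod (ip V x (us ! i)))\<^sup>2 * f (p i)))"
    using x by (intro sum.cong refl) (simp add: self_adjoint_ip[OF T] eig complex_norm_square[symmetric] del: of_real_power)
  also have "\<dots> = complex_of_real (integral\<^sup>L (diagonal_measure V (eigen_measure us p) x) f)"
    unfolding diagonal_measure_eigen_measure[OF on x]
    by (subst integral_point_masses(2)) (use f in auto)
  finally show "ip V (T x) x = complex_of_real (integral\<^sup>L (diagonal_measure V (eigen_measure us p) x) f)" .
qed

lemma joint_spectral_measure_eigen_measure: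
  assumes on: "orthonormal us" and full: "span (set us) = carrier V"
    and T: "self_adjoint_op V T1" "self_adjoint_op V T2"
    and eig: "\<And>j. j < length us \<Longrightarrow> T1 (us ! j) = complex_of_real (a j) \<odot>\<^bsub>V\<^esub> us ! j"
      "\<And>j. j < length us \<Longrightarrow> T2 (us ! j) = complex_of_real (b j) \<odot>\<^bsub>V\<^esub> us ! j"
  shows "joint_spectral_measure V (eigen_measure us (\<lambda>j. (a j, b j))) T1 T2"
proof -
  have m: "(fst :: real \<times> real \<Rightarrow> real) \<in> borel_measurable borel"
    "(snd :: real \<times> real \<Rightarrow> real) \<in> borel_measurable borel"
    by (simp_all add: borel_prod[symmetric])
  show ?thesis
    unfolding joint_spectral_measure_def
    using spectral_measure_eigen_measure[OF on full]
      spectral_integral_eigen_measure[OF on full T(1) _ m(1), of "\<lambda>j. (a j, b j)"]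
      spectral_integral_eigen_measure[OF on full T(2) _ m(2), of "\<lambda>j. (a j, b j)"] eig
    by simp
qed

end

section \<open>The associated Hilbert space\<close>

lemma lookup_scale: "Poly_Mapping.lookup (Poly_Mapping.single 0 c * (p :: poly2)) m = c * Poly_Mapping.lookup p m"
  by (simp add: mult_map_scale_conv_mult[symmetric] Poly_Mapping.map.rep_eq when_def)

lemma mem_poly_space: "p \<in> poly_space k \<rho> \<longleftrightarrow> (\<forall>m. m \<notin> k ` {0..\<rho>} \<longrightarrow> Poly_Mapping.lookup p m = 0)"
  by (auto simp: poly_space_def in_keys_iff)

lemma poly_space_closed [simp]:
  "0 \<in> poly_space k \<rho>"
  "p \<in> poly_space k \<rho> \<Longrightarrow> q \<in> poly_space k \<rho> \<Longrightarrow> p + q \<in> poly_space k \<rho>"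
  "p \<in> poly_space k \<rho> \<Longrightarrow> q \<in> poly_space k \<rho> \<Longrightarrow> p - q \<in> poly_space k \<rho>"
  "p \<in> poly_space k \<rho> \<Longrightarrow> Poly_Mapping.single 0 c * p \<in> poly_space k \<rho>"
  by (simp_all add: mem_poly_space lookup_add lookup_minus lookup_scale)

lemma single_in_poly_space [simp]:
  "m \<in> k ` {0..\<rho>} \<Longrightarrow> Poly_Mapping.single m c \<in> poly_space k \<rho>"
  by (simp add: poly_space_def)

lemma poly_space_sum [simp]:
  "(\<forall>i\<in>I. f i \<in> poly_space k \<rho>) \<Longrightarrow> sum f I \<in> poly_space k \<rho>"
  by (induction I rule: infinite_finite_induct) auto

lemma poly_form_add_left: "poly_form s k \<rho> (p + q) u = poly_form s k \<rho> p u + poly_form s k \<rho> q u"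
  by (simp add: poly_form_def lookup_add sum.distrib distrib_right)

lemma poly_form_minus_left: "poly_form s k \<rho> (p - q) u = poly_form s k \<rho> p u - poly_form s k \<rho> q u"
  using poly_form_add_left[of s k \<rho> "p - q" q u] by simp

lemma poly_form_scale_left: "poly_form s k \<rho> (Poly_Mapping.single 0 c * p) u = c * poly_form s k \<rho> p u"
  by (simp add: poly_form_def lookup_scale sum_distrib_left mult.assoc)

lemma poly_form_cnj: "poly_form s k \<rho> q p = cnj (poly_form s k \<rho> p q)"
proof -
  have "cnj (poly_form s k \<rho> p q) = (\<Sum>j\<in>{0..\<rho>}. \<Sum>m\<in>{0..\<rho>}.
      cnj (Poly_Mapping.lookup p (k j)) * Poly_Mapping.lookup q (k m) * complex_of_real (s (k j + k m)))"
    by (simp add: poly_form_def)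
  also have "\<dots> = poly_form s k \<rho> q p"
    unfolding poly_form_def by (subst sum.swap) (simp add: mult.commute add.commute)
  finally show ?thesis ..
qed

lemma poly_form_add_right: "poly_form s k \<rho> u (p + q) = poly_form s k \<rho> u p + poly_form s k \<rho> u q"
  using poly_form_cnj[of s k \<rho> u "p + q"] poly_form_cnj[of s k \<rho> u p] poly_form_cnj[of s k \<rho> u q]
  by (simp add: poly_form_add_left)

lemma poly_form_minus_right: "poly_form s k \<rho> u (p - q) = poly_form s k \<rho> u p - poly_form s k \<rho> u q"
  using poly_form_add_right[of s k \<rho> u "p - q" q] by simp

lemma poly_form_scale_right: "poly_form s k \<rho> u (Poly_Mapping.single 0 c * p) = cnj c * poly_form s k \<rho> u p"
  using poly_form_cnj[of s k \<rho> u "Poly_Mapping.single 0 c * p"] poly_form_cnj[of s k \<rho> u p]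
  by (simp add: poly_form_scale_left)

lemmas poly_form_linear = poly_form_add_left poly_form_add_right poly_form_minus_left
  poly_form_minus_right poly_form_scale_left poly_form_scale_right

lemma poly_form_zero [simp]: "poly_form s k \<rho> 0 p = 0" "poly_form s k \<rho> p 0 = 0"
  by (simp_all add: poly_form_def)

lemma poly_form_sum_left: "poly_form s k \<rho> (\<Sum>i\<in>I. f i) p = (\<Sum>i\<in>I. poly_form s k \<rho> (f i) p)"
  by (induction I rule: infinite_finite_induct) (auto simp: poly_form_linear)

lemma poly_form_sum_right: "poly_form s k \<rho> p (\<Sum>i\<in>I. f i) = (\<Sum>i\<in>I. poly_form s k \<rho> p (f i))"
  by (induction I rule: infinite_finite_induct) (auto simp: poly_form_linear)

locale psd_moments =
  fixes s :: "nat \<times> nat \<Rightarrow> real" and k :: "nat \<Rightarrow> nat \<times> nat" and \<rho> :: nat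
  assumes psd: "psd_mat (Gamma s k \<rho>)"
begin

abbreviation P where "P \<equiv> poly_space k \<rho>"
abbreviation F where "F \<equiv> poly_form s k \<rho>"
abbreviation H where "H \<equiv> H_space s k \<rho>"
abbreviation \<C> where "\<C> \<equiv> cls s k \<rho>"

lemma form_nonneg: "0 \<le> Re (F p p)"
proof -
  define v where "v = Matrix.vec (Suc \<rho>) (\<lambda>j. Poly_Mapping.lookup p (k j))"
  have "(Gamma s k \<rho> *\<^sub>v v) \<bullet>c v = F p p"
  proof -
    have "(Gamma s k \<rho> *\<^sub>v v) \<bullet>c v
        = (\<Sum>m\<in>{0..\<rho>}. \<Sum>j\<in>{0..\<rho>}. Poly_Mapping.lookup p (k j) * cnj (Poly_Mapping.lookup p (k m))
            * complex_of_real (s (k j + k m)))"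
      by (simp add: v_def Gamma_def scalar_prod_def atLeastLessThanSuc_atLeastAtMost
          sum_distrib_left sum_distrib_right mult_ac)
    then show ?thesis unfolding poly_form_def by (subst sum.swap) simp
  qed
  moreover have "v \<in> carrier_vec (dim_col (Gamma s k \<rho>))"
    by (simp add: v_def Gamma_def)
  ultimately have "0 \<le> F p p"
    using psd by (metis psd_mat_def)
  then show ?thesis by (simp add: less_eq_complex_def)
qed

lemma form_self_real: "F p p = complex_of_real (Re (F p p))"
  using poly_form_cnj[of s k \<rho> p p] by (simp add: complex_eq_iff)

text \<open>
  The degenerate case of the Cauchy--Schwarz inequality. It makes the null vectors a subspace and the
  form well defined on classes.
\<close>

lemma null_form:
  assumes "F p p = 0"
  shows "F p q = 0"
proof (rule ccontr)
  define z where "z = F p q"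
  assume "F p q \<noteq> 0"
  then have z: "0 < (cmod z)\<^sup>2" by (simp add: z_def)
  \<comment> \<open>If z = F p q were nonzero, this t would give F (c p + q) (c p + q) = - 2 t |z|^2 + F q q = -1.\<close>
  define t where "t = (Re (F q q) + 1) / (2 * (cmod z)\<^sup>2)"
  define c where "c = - (complex_of_real t * cnj z)"
  have "F q p = cnj z" using poly_form_cnj[of s k \<rho> q p] by (simp add: z_def)
  then have "F (Poly_Mapping.single 0 c * p + q) (Poly_Mapping.single 0 c * p + q) = c * z + cnj (c * z) + F q q"
    using assms by (simp add: poly_form_linear z_def)
  moreover have "c * z = complex_of_real (- (t * (cmod z)\<^sup>2))"
    by (simp add: c_def mult.assoc complex_norm_square mult.commute[of "cnj z"] del: of_real_power)
  ultimately have "0 \<le> - 2 * (t * (cmod z)\<^sup>2) + Re (F q q)"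
    using form_nonneg[of "Poly_Mapping.single 0 c * p + q"] by simp
  moreover have "2 * (t * (cmod z)\<^sup>2) = Re (F q q) + 1"
    using z by (simp add: t_def)
  ultimately show False by simp
qed

lemma null_form_right: "F p p = 0 \<Longrightarrow> F q p = 0"
  using null_form[of p q] poly_form_cnj[of s k \<rho> q p] by simp

lemma null_form_add:
  assumes "F p p = 0" "F q q = 0"
  shows "F (p + q) (p + q) = 0"
  by (simp add: poly_form_linear null_form[OF assms(1)] null_form[OF assms(2)])

lemma equiv_null_rel: "equiv P (null_rel s k \<rho>)"
proof (rule equivI)
  show "null_rel s k \<rho> \<subseteq> P \<times> P" by (auto simp: null_rel_def)
  show "refl_on P (null_rel s k \<rho>)" by (auto simp: null_rel_def refl_on_def)
  have "F (q - p) (q - p) = F (p - q) (p - q)" for p q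
    by (simp add: poly_form_linear)
  then show "sym (null_rel s k \<rho>)"
    by (auto simp: null_rel_def sym_def)
  show "trans (null_rel s k \<rho>)"
  proof (rule transI)
    fix p q u assume "(p, q) \<in> null_rel s k \<rho>" "(q, u) \<in> null_rel s k \<rho>"
    then show "(p, u) \<in> null_rel s k \<rho>"
      using null_form_add[of "p - q" "q - u"] by (auto simp: null_rel_def)
  qed
qed

lemma cls_eq_iff: "p \<in> P \<Longrightarrow> q \<in> P \<Longrightarrow> \<C> p = \<C> q \<longleftrightarrow> F (p - q) (p - q) = 0"
  using eq_equiv_class_iff[OF equiv_null_rel, of p q] by (simp add: cls_def null_rel_def)

lemma carrier_H: "carrier H = \<C> ` P"
  by (auto simp: H_space_def quotient_def cls_def)

lemma cls_in_carrier [simp]: "p \<in> P \<Longrightarrow> \<C> p \<in> carrier H"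
  by (simp add: carrier_H)

lemma zero_H: "\<zero>\<^bsub>H\<^esub> = \<C> 0"
  by (simp add: H_space_def)

lemma add_H: "p \<in> P \<Longrightarrow> q \<in> P \<Longrightarrow> \<C> p \<oplus>\<^bsub>H\<^esub> \<C> q = \<C> (p + q)"
proof -
  assume "p \<in> P" "q \<in> P"
  moreover have "congruent2 (null_rel s k \<rho>) (null_rel s k \<rho>) (\<lambda>p q. \<C> (p + q))"
  proof (rule congruent2I')
    fix p p' q q' assume "(p, p') \<in> null_rel s k \<rho>" "(q, q') \<in> null_rel s k \<rho>"
    then show "\<C> (p + q) = \<C> (p' + q')"
      using null_form_add[of "p - p'" "q - q'"]
      by (subst cls_eq_iff) (auto simp: null_rel_def algebra_simps)
  qed
  ultimately show ?thesis
    using UN_equiv_class2[OF equiv_null_rel equiv_null_rel]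
    by (simp add: H_space_def cls_def[of s k \<rho> p] cls_def[of s k \<rho> q])
qed

lemma smult_H: "p \<in> P \<Longrightarrow> c \<odot>\<^bsub>H\<^esub> \<C> p = \<C> (Poly_Mapping.single 0 c * p)"
proof -
  assume "p \<in> P"
  moreover have "congruent (null_rel s k \<rho>) (\<lambda>p. \<C> (Poly_Mapping.single 0 c * p))"
    by (rule congruentI) (auto simp: null_rel_def cls_eq_iff right_diff_distrib[symmetric] poly_form_linear
        simp del: poly_form_minus_left poly_form_minus_right)
  ultimately show ?thesis
    using UN_equiv_class[OF equiv_null_rel]
    by (simp add: H_space_def cls_def[of s k \<rho> p])
qed

lemma ip_H: "p \<in> P \<Longrightarrow> q \<in> P \<Longrightarrow> ip H (\<C> p) (\<C> q) = F p q"
proof -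
  assume pq: "p \<in> P" "q \<in> P"
  have c: "congruent2 (null_rel s k \<rho>) (null_rel s k \<rho>) (\<lambda>p q. {F p q})"
  proof (rule congruent2I')
    fix p p' q q' assume "(p, p') \<in> null_rel s k \<rho>" "(q, q') \<in> null_rel s k \<rho>"
    then have "F (p - p') q = 0" "F p' (q - q') = 0"
      by (auto simp: null_rel_def intro: null_form null_form_right)
    then show "{F p q} = {F p' q'}" by (simp add: poly_form_linear)
  qed
  show ?thesis
    using UN_equiv_class2[OF equiv_null_rel equiv_null_rel c pq] by (simp add: H_space_def cls_def)
qed

lemma carrier_cases:
  assumes "x \<in> carrier H"
  obtains p where "p \<in> P" "x = \<C> p"
  using assms by (auto simp: carrier_H)

lemma vectorspace_H: "vectorspace (class_ring :: complex ring) H"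
proof -
  have scale: "Poly_Mapping.single 0 (a * b) * p = Poly_Mapping.single 0 a * (Poly_Mapping.single 0 b * p)"
    "Poly_Mapping.single 0 (a + b) * p = Poly_Mapping.single 0 a * p + Poly_Mapping.single 0 b * p"
    "Poly_Mapping.single 0 1 * p = p" for a b :: complex and p :: poly2
    by (simp_all add: poly_mapping_eq_iff fun_eq_iff lookup_scale lookup_add distrib_right)
  show ?thesis
  proof (rule vs_criteria)
    show "\<forall>v\<in>carrier H. \<exists>neg_v\<in>carrier H. v \<oplus>\<^bsub>H\<^esub> neg_v = \<zero>\<^bsub>H\<^esub>"
    proof
      fix v assume "v \<in> carrier H"
      then obtain p where "p \<in> P" "v = \<C> p" by (rule carrier_cases)
      then show "\<exists>neg_v\<in>carrier H. v \<oplus>\<^bsub>H\<^esub> neg_v = \<zero>\<^bsub>H\<^esub>"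
        by (intro bexI[of _ "\<C> (0 - p)"]) (simp_all add: add_H zero_H del: diff_0)
    qed
    show "\<forall>v w. v \<in> carrier H \<and> w \<in> carrier H \<longrightarrow> v \<oplus>\<^bsub>H\<^esub> w = w \<oplus>\<^bsub>H\<^esub> v"
      by (clarsimp simp: carrier_H add_H) (metis add.commute)
  qed (auto simp: carrier_H add_H smult_H zero_H scale distrib_left add.assoc
      intro!: class_field.field_axioms imageI arg_cong[of _ _ \<C>] simp del: single_one)
qed

sublocale ip_space H
proof -
  interpret vectorspace "class_ring :: complex ring" H by (rule vectorspace_H)
  show "ip_space H"
  proof
    fix x assume "x \<in> carrier H" "x \<noteq> \<zero>\<^bsub>H\<^esub>"
    then obtain p where p: "p \<in> P" "x = \<C> p" "\<C> p \<noteq> \<C> 0"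
      by (metis carrier_cases zero_H)
    then have "F p p \<noteq> 0" by (simp add: cls_eq_iff)
    then have "Re (F p p) \<noteq> 0" using form_self_real[of p] by auto
    then show "0 < Re (ip H x x)"
      using form_nonneg[of p] p by (simp add: ip_H)
  next
    fix x y assume "x \<in> carrier H" "y \<in> carrier H"
    then show "ip H y x = cnj (ip H x y)"
      by (auto simp: carrier_H ip_H intro: poly_form_cnj)
  qed (auto simp: carrier_H add_H smult_H ip_H poly_form_linear)
qed

lemma finsum_H:
  "finite I \<Longrightarrow> \<forall>i\<in>I. f i \<in> P \<Longrightarrow> (\<Oplus>\<^bsub>H\<^esub> i\<in>I. \<C> (f i)) = \<C> (\<Sum>i\<in>I. f i)"
  by (induction I rule: finite_induct) (auto simp: zero_H add_H Pi_def)

lemma smult_monomial: "m \<in> k ` {0..\<rho>} \<Longrightarrow>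
    c \<odot>\<^bsub>H\<^esub> \<C> (Poly_Mapping.single m a) = \<C> (Poly_Mapping.single m (c * a))"
  by (simp add: smult_H mult_single)

end

section \<open>The multiplication operators\<close>

lemma downclosed_nat_eq_lessThan:
  fixes A :: "nat set"
  assumes "finite A" "\<And>i j. j \<in> A \<Longrightarrow> i < j \<Longrightarrow> i \<in> A"
  obtains n where "A = {..<n}"
proof -
  define n where "n = (LEAST n. n \<notin> A)"
  have "\<exists>n. n \<notin> A" using assms(1) by (metis ex_new_if_finite infinite_UNIV_nat)
  then have "n \<notin> A" unfolding n_def by (rule LeastI_ex)
  moreover have "i \<in> A" if "i < n" for i
    using not_less_Least that unfolding n_def by blast
  ultimately have "A = {..<n}"
    using assms(2) by (metis lessThan_iff linorder_neqE_nat subsetI subset_antisym)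
  then show ?thesis by (rule that)
qed

locale truncated_moments = psd_moments s k \<rho>
  for s :: "nat \<times> nat \<Rightarrow> real" and k :: "nat \<Rightarrow> nat \<times> nat" and \<rho> :: nat +
  fixes r :: nat
  assumes r: "r \<ge> 1"
    and bij: "bij_betw k {0..\<rho>} (K_deg r)"
    and order: "\<forall>i\<in>{0..\<rho>}. \<forall>j\<in>{0..\<rho>}. k i \<in> K_deg (r - 1) \<and> k j \<notin> K_deg (r - 1) \<longrightarrow> i < j"
    and ker: "\<forall>l\<in>{1, 2}. mat_kernel (Gamma_sub s k \<rho> l) \<subseteq> mat_kernel (Gamma_hat s k \<rho> l)"
begin

abbreviation mon :: "nat \<times> nat \<Rightarrow> poly2" where "mon m \<equiv> Poly_Mapping.single m 1"
abbreviation \<Omega> :: "nat set" where "\<Omega> \<equiv> Omega0 k \<rho>"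

lemma image_k: "k ` {0..\<rho>} = K_deg r"
  using bij by (simp add: bij_betw_def)

lemma inj_k: "inj_on k {0..\<rho>}"
  using bij by (simp add: bij_betw_def)

lemma shift_in_K_deg: "k j + unit_index l \<in> K_deg r \<longleftrightarrow> k j \<in> K_deg (r - 1)"
  using r by (auto simp: K_deg_def unit_index_def)

lemma Omega0_eq: "\<Omega> = {j \<in> {0..\<rho>}. k j \<in> K_deg (r - 1)}"
  by (auto simp: Omega0_def image_k shift_in_K_deg)

lemma Omega_eq: "Omega k \<rho> l = \<Omega>"
  by (auto simp: Omega_def Omega0_eq image_k shift_in_K_deg)

lemma finite_Omega [simp]: "finite \<Omega>"
  by (simp add: Omega0_eq)

lemma Omega_subset: "j \<in> \<Omega> \<Longrightarrow> j \<in> {0..\<rho>}"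
  by (simp add: Omega0_eq)

lemma k_in [simp]: "j \<in> \<Omega> \<Longrightarrow> k j \<in> k ` {0..\<rho>}"
  using Omega_subset by blast

lemma k_shift_in [simp]: "j \<in> \<Omega> \<Longrightarrow> k j + unit_index l \<in> k ` {0..\<rho>}"
  unfolding image_k shift_in_K_deg by (simp add: Omega0_eq)

text \<open>
  The indexation lists the exponents of degree below \<open>r\<close> first, so the index set of the domain is an
  initial segment.
\<close>

lemma Omega_initial: obtains N where "\<Omega> = {..<N}" "N \<le> Suc \<rho>"
proof -
  have "i \<in> \<Omega>" if "j \<in> \<Omega>" "i < j" for i j
    using that order by (force simp: Omega0_eq)
  then obtain N where N: "\<Omega> = {..<N}"
    using downclosed_nat_eq_lessThan[OF finite_Omega] by blast
  have "N \<le> Suc \<rho>"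
  proof (rule ccontr)
    assume "\<not> N \<le> Suc \<rho>"
    then have "Suc \<rho> \<in> \<Omega>" using N by simp
    then show False using Omega_subset by fastforce
  qed
  with N show ?thesis by (rule that)
qed

lemma form_monomial:
  assumes "x \<in> k ` {0..\<rho>}" "y \<in> k ` {0..\<rho>}"
  shows "F (Poly_Mapping.single x a) (Poly_Mapping.single y b) = a * cnj b * complex_of_real (s (x + y))"
proof -
  obtain i j where ij: "i \<in> {0..\<rho>}" "j \<in> {0..\<rho>}" "x = k i" "y = k j"
    using assms by auto
  have eq: "k i = k m \<longleftrightarrow> m = i" "k j = k m \<longleftrightarrow> m = j" if "m \<in> {0..\<rho>}" for m
    using inj_k ij that by (auto dest: inj_onD)
  have "F (Poly_Mapping.single x a) (Poly_Mapping.single y b)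
      = (\<Sum>l\<in>{0..\<rho>}. \<Sum>m\<in>{0..\<rho>}. if l = i then if m = j then a * cnj b * complex_of_real (s (x + y)) else 0 else 0)"
    unfolding poly_form_def
    using ij by (intro sum.cong refl) (simp add: lookup_single when_def eq)
  also have "\<dots> = (\<Sum>l\<in>{0..\<rho>}. if l = i then \<Sum>m\<in>{0..\<rho>}. if m = j then a * cnj b * complex_of_real (s (x + y)) else 0 else 0)"
    by (intro sum.cong) auto
  also have "\<dots> = a * cnj b * complex_of_real (s (x + y))"
    using ij by simp
  finally show ?thesis .
qed

text \<open>
  The classes of these polynomials form \<open>H\<^sub>0\<close>; \<open>t_times l\<close> below is their product with \<open>t\<^sub>l\<close>.
\<close>

definition dom_poly :: "(nat \<Rightarrow> complex) \<Rightarrow> poly2" where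
  "dom_poly \<alpha> = (\<Sum>j\<in>\<Omega>. Poly_Mapping.single (k j) (\<alpha> j))"

definition t_times :: "nat \<Rightarrow> (nat \<Rightarrow> complex) \<Rightarrow> poly2" where
  "t_times l \<alpha> = (\<Sum>j\<in>\<Omega>. Poly_Mapping.single (k j + unit_index l) (\<alpha> j))"

lemma dom_poly_in [simp]: "dom_poly \<alpha> \<in> P" "t_times l \<alpha> \<in> P"
  unfolding dom_poly_def t_times_def
  by (rule poly_space_sum; intro ballI single_in_poly_space k_in k_shift_in; assumption)+

lemma dom_poly_diff: "dom_poly \<alpha> - dom_poly \<beta> = dom_poly (\<lambda>j. \<alpha> j - \<beta> j)" "t_times l \<alpha> - t_times l \<beta> = t_times l (\<lambda>j. \<alpha> j - \<beta> j)"
  by (simp_all add: dom_poly_def t_times_def single_diff sum_subtractf)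

lemma dom_poly_add: "dom_poly \<alpha> + dom_poly \<beta> = dom_poly (\<lambda>j. \<alpha> j + \<beta> j)" "t_times l \<alpha> + t_times l \<beta> = t_times l (\<lambda>j. \<alpha> j + \<beta> j)"
  by (simp_all add: dom_poly_def t_times_def single_add sum.distrib)

lemma dom_poly_scale: "Poly_Mapping.single 0 c * dom_poly \<alpha> = dom_poly (\<lambda>j. c * \<alpha> j)"
  "Poly_Mapping.single 0 c * t_times l \<alpha> = t_times l (\<lambda>j. c * \<alpha> j)"
  by (simp_all add: dom_poly_def t_times_def sum_distrib_left mult_single)

lemma dom_poly_unit: 
  assumes "j \<in> \<Omega>"
  shows "dom_poly (\<lambda>i. if i = j then c else 0) = Poly_Mapping.single (k j) c"
    and "t_times l (\<lambda>i. if i = j then c else 0) = Poly_Mapping.single (k j + unit_index l) c"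
proof -
  have "Poly_Mapping.single m (if i = j then c else 0) = (if i = j then Poly_Mapping.single m c else 0)"
    for m :: "nat \<times> nat" and i by simp
  then show "dom_poly (\<lambda>i. if i = j then c else 0) = Poly_Mapping.single (k j) c"
    "t_times l (\<lambda>i. if i = j then c else 0) = Poly_Mapping.single (k j + unit_index l) c"
    using assms by (simp_all add: dom_poly_def t_times_def sum.delta cong: if_cong)
qed

text \<open>
  The kernel condition in terms of polynomials. The coefficient vector of a null polynomial \<open>p\<close> of
  degree below \<open>r\<close> lies in \<open>Ker \<Gamma>\<^sub>l\<close>, hence in the kernel of the shifted matrix, which says that
  \<open>t\<^sub>l p\<close> is orthogonal to every \<open>t\<^sub>l t\<^sup>m\<close> with \<open>m\<close> of degree below \<open>r\<close>, and so to itself.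
\<close>

lemma t_times_null:
  assumes l: "l \<in> {1, 2}" and null: "F (dom_poly \<alpha>) (dom_poly \<alpha>) = 0"
  shows "F (t_times l \<alpha>) (t_times l \<alpha>) = 0"
proof -
  obtain N where N: "\<Omega> = {..<N}" using Omega_initial by blast
  have list: "sorted_list_of_set (Omega k \<rho> l) = [0..<N]"
    by (simp add: Omega_eq N lessThan_atLeast0)
  define v where "v = Matrix.vec N \<alpha>"
  have "Gamma_sub s k \<rho> l *\<^sub>v v = 0\<^sub>v N"
  proof (rule eq_vecI)
    fix m assume "m < dim_vec (0\<^sub>v N)"
    then have m: "m < N" "m \<in> \<Omega>" by (simp_all add: N)
    have "(Gamma_sub s k \<rho> l *\<^sub>v v) $ m = (\<Sum>j<N. \<alpha> j * complex_of_real (s (k j + k m)))"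
      using m by (simp add: Gamma_sub_def Let_def list v_def scalar_prod_def lessThan_atLeast0 mult.commute)
    also have "\<dots> = F (dom_poly \<alpha>) (mon (k m))"
      using m(2) unfolding dom_poly_def poly_form_sum_left N[symmetric]
      by (intro sum.cong refl) (simp add: form_monomial)
    also have "\<dots> = 0" by (rule null_form[OF null])
    finally show "(Gamma_sub s k \<rho> l *\<^sub>v v) $ m = 0\<^sub>v N $ m" using m by simp
  qed (simp add: Gamma_sub_def Let_def list)
  then have "v \<in> mat_kernel (Gamma_sub s k \<rho> l)"
    by (simp add: mat_kernel_def v_def Gamma_sub_def Let_def list)
  then have "v \<in> mat_kernel (Gamma_hat s k \<rho> l)"
    using ker l by blast
  then have hat: "Gamma_hat s k \<rho> l *\<^sub>v v = 0\<^sub>v N"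
    by (simp add: mat_kernel_def Gamma_hat_def Let_def list)
  have "F (t_times l \<alpha>) (Poly_Mapping.single (k m + unit_index l) c) = 0" if m: "m \<in> \<Omega>" for m c
  proof -
    have "F (t_times l \<alpha>) (Poly_Mapping.single (k m + unit_index l) c)
        = cnj c * (\<Sum>j<N. \<alpha> j * complex_of_real (s (k j + unit_index l + k m + unit_index l)))"
      using m unfolding t_times_def poly_form_sum_left N[symmetric] sum_distrib_left
      by (intro sum.cong refl) (simp add: form_monomial add.assoc mult_ac)
    also have "\<dots> = cnj c * (Gamma_hat s k \<rho> l *\<^sub>v v) $ m"
      using m by (simp add: Gamma_hat_def Let_def list v_def scalar_prod_def lessThan_atLeast0 mult.commute N)
    finally show ?thesis using m by (simp add: hat N)
  qed
  then show ?thesis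
    by (subst (2) t_times_def) (simp add: poly_form_sum_right)
qed

text \<open>
  Two representatives of a class differ by a null polynomial, and so do their products with \<open>t\<^sub>l\<close>;
  this makes the value of \<open>M\<^sub>l\<close> unique.
\<close>

lemma M_op_cls:
  assumes l: "l \<in> {1, 2}"
  shows "M_op s k \<rho> l (\<C> (dom_poly \<alpha>)) = \<C> (t_times l \<alpha>)"
  unfolding M_op_def Omega_eq dom_poly_def[symmetric] t_times_def[symmetric]
proof (rule the_equality)
  fix Y assume "\<exists>\<beta>. \<C> (dom_poly \<alpha>) = \<C> (dom_poly \<beta>) \<and> Y = \<C> (t_times l \<beta>)"
  then obtain \<beta> where "\<C> (dom_poly \<alpha>) = \<C> (dom_poly \<beta>)" "Y = \<C> (t_times l \<beta>)" by blast
  then show "Y = \<C> (t_times l \<alpha>)"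
    using t_times_null[OF l, of "\<lambda>j. \<alpha> j - \<beta> j"]
    by (metis cls_eq_iff dom_poly_in dom_poly_diff)
qed blast

lemma cls_monomial_in [simp]: "m \<in> K_deg r \<Longrightarrow> \<C> (Poly_Mapping.single m c) \<in> carrier H"
  by (simp add: image_k)

lemma cls_sum_in_span:
  assumes "J \<subseteq> {0..\<rho>}"
  shows "\<C> (\<Sum>j\<in>J. Poly_Mapping.single (k j) (\<alpha> j)) \<in> span ((\<lambda>j. \<C> (mon (k j))) ` J)"
proof -
  have fin: "finite J" using assms by (rule finite_subset) simp
  have sub: "(\<lambda>j. \<C> (mon (k j))) ` J \<subseteq> carrier H"
    using assms by auto
  have "\<C> (\<Sum>j\<in>J. Poly_Mapping.single (k j) (\<alpha> j))
      = (\<Oplus>\<^bsub>H\<^esub> j\<in>J. \<C> (Poly_Mapping.single (k j) (\<alpha> j)))"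
    using assms fin by (subst finsum_H) auto
  also have "\<dots> = (\<Oplus>\<^bsub>H\<^esub> j\<in>J. \<alpha> j \<odot>\<^bsub>H\<^esub> \<C> (mon (k j)))"
    using assms by (intro finsum_cong') (auto simp: smult_monomial)
  also have "\<dots> \<in> span ((\<lambda>j. \<C> (mon (k j))) ` J)"
    using in_own_span[OF sub]
    by (intro subspace_finsum span_is_submodule[OF sub] subspace_smult fin) auto
  finally show ?thesis .
qed

lemma H0_eq: "H0_sub s k \<rho> = range (\<lambda>\<alpha>. \<C> (dom_poly \<alpha>))"
proof
  have "submodule class_ring (range (\<lambda>\<alpha>. \<C> (dom_poly \<alpha>))) H"
  proof (rule submoduleI)
    have "\<C> 0 = \<C> (dom_poly (\<lambda>_. 0))" by (simp add: dom_poly_def)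
    then show "\<zero>\<^bsub>H\<^esub> \<in> range (\<lambda>\<alpha>. \<C> (dom_poly \<alpha>))" unfolding zero_H by blast
  qed (auto simp: add_H smult_H dom_poly_add dom_poly_scale)
  moreover have "\<C> (mon (k j)) \<in> range (\<lambda>\<alpha>. \<C> (dom_poly \<alpha>))" if "j \<in> \<Omega>" for j
    using dom_poly_unit(1)[OF that, of 1] by (metis rangeI)
  ultimately show "H0_sub s k \<rho> \<subseteq> range (\<lambda>\<alpha>. \<C> (dom_poly \<alpha>))"
    unfolding H0_sub_def by (intro span_minimal) auto
  show "range (\<lambda>\<alpha>. \<C> (dom_poly \<alpha>)) \<subseteq> H0_sub s k \<rho>"
    using cls_sum_in_span[of \<Omega>] Omega_subset unfolding dom_poly_def H0_sub_def by blast
qed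

lemma M_dom_eq: "M_dom s k \<rho> l = H0_sub s k \<rho>"
  by (simp add: M_dom_def H0_sub_def Omega_eq)

lemma H0_submodule: "submodule class_ring (H0_sub s k \<rho>) H"
  unfolding H0_sub_def by (rule span_is_submodule) auto

lemma H0_carrier: "x \<in> H0_sub s k \<rho> \<Longrightarrow> x \<in> carrier H"
  by (auto simp: H0_eq)

lemma
  assumes "l \<in> {1, 2}" "x \<in> H0_sub s k \<rho>" 
  shows M_op_closed: "M_op s k \<rho> l x \<in> carrier H"
    and M_op_smult: "M_op s k \<rho> l (c \<odot>\<^bsub>H\<^esub> x) = c \<odot>\<^bsub>H\<^esub> M_op s k \<rho> l x"
    and M_op_add: "y \<in> H0_sub s k \<rho> \<Longrightarrow> M_op s k \<rho> l (x \<oplus>\<^bsub>H\<^esub> y) = M_op s k \<rho> l x \<oplus>\<^bsub>H\<^esub> M_op s k \<rho> l y"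
  using assms by (auto simp: H0_eq M_op_cls smult_H add_H dom_poly_add dom_poly_scale)

text \<open>
  A moment depends only on the sum of its two exponents, so \<open>t\<^sub>l\<close> can be moved across the form.
\<close>

lemma M_op_symmetric:
  assumes l: "l \<in> {1, 2}" and "x \<in> H0_sub s k \<rho>" "y \<in> H0_sub s k \<rho>"
  shows "ip H (M_op s k \<rho> l x) y = ip H x (M_op s k \<rho> l y)"
proof -
  obtain \<alpha> \<beta> where [simp]: "x = \<C> (dom_poly \<alpha>)" "y = \<C> (dom_poly \<beta>)"
    using assms by (auto simp: H0_eq)
  have "F (t_times l \<alpha>) (dom_poly \<beta>) = (\<Sum>m\<in>\<Omega>. \<Sum>j\<in>\<Omega>. \<alpha> j * cnj (\<beta> m) * complex_of_real (s (k j + unit_index l + k m)))"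
    unfolding t_times_def dom_poly_def poly_form_sum_left poly_form_sum_right
    by (intro sum.cong refl) (simp add: form_monomial)
  also have "\<dots> = F (dom_poly \<alpha>) (t_times l \<beta>)"
    unfolding t_times_def dom_poly_def poly_form_sum_left poly_form_sum_right
    by (intro sum.cong refl) (simp add: form_monomial add.assoc add.commute[of "unit_index l"])
  finally show ?thesis
    by (simp add: M_op_cls[OF l] ip_H)
qed

lemma M_op_monomial:
  assumes "l \<in> {1, 2}" "m \<in> K_deg (r - 1)"
  shows "\<C> (mon m) \<in> H0_sub s k \<rho>" "M_op s k \<rho> l (\<C> (mon m)) = \<C> (mon (m + unit_index l))"
proof -
  have "m \<in> k ` {0..\<rho>}" using assms(2) unfolding image_k by (auto simp: K_deg_def)
  then obtain j where j: "j \<in> {0..\<rho>}" "m = k j" by auto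
  then have O: "j \<in> \<Omega>" using assms(2) by (simp add: Omega0_eq)
  define \<alpha> :: "nat \<Rightarrow> complex" where "\<alpha> = (\<lambda>i. if i = j then 1 else 0)"
  have \<alpha>: "mon m = dom_poly \<alpha>" "mon (m + unit_index l) = t_times l \<alpha>"
    unfolding \<alpha>_def j(2) by (rule dom_poly_unit[OF O, symmetric])+
  show "\<C> (mon m) \<in> H0_sub s k \<rho>"
    unfolding \<alpha> H0_eq by (rule rangeI)
  show "M_op s k \<rho> l (\<C> (mon m)) = \<C> (mon (m + unit_index l))"
    unfolding \<alpha> by (rule M_op_cls[OF assms(1)])
qed

section \<open>The orthonormal basis adapted to the domain\<close>

abbreviation g where "g \<equiv> g_basis s k \<rho>"
abbreviation n\<^sub>0 where "n\<^sub>0 \<equiv> H0_dim s k \<rho>"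
abbreviation i\<^sub>s where "i\<^sub>s \<equiv> nsa_index s k \<rho>"

text \<open>
  The monomials that span \<open>H\<^sub>0\<close> come first, so the orthonormal list obtained from them alone is an
  initial segment of the basis of \<open>H\<close>; the remaining elements span the orthogonal complement of
  \<open>H\<^sub>0\<close>. Counting the two parts identifies the sizes of the matrices \<open>A\<^sub>l\<close> and \<open>B\<^sub>l\<close>.
\<close>

lemma g_basis_split:
  obtains g1 g2 where "g = g1 @ g2" "orthonormal (g1 @ g2)" "span (set (g1 @ g2)) = carrier H"
    "span (set g1) = H0_sub s k \<rho>" "length g1 = n\<^sub>0" "length g2 = i\<^sub>s"
proof -
  let ?e = "\<lambda>j. \<C> (mon (k j))"
  obtain N where N: "\<Omega> = {..<N}" "N \<le> Suc \<rho>" by (rule Omega_initial)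
  have split: "[0..<\<rho> + 1] = [0..<N] @ [N..<\<rho> + 1]"
    using N(2) by (metis Suc_eq_plus1 le0 le_add_diff_inverse upt_add_eq_append)
  have gdef: "g = gram_schmidt_basis H (map ?e [0..<N] @ map ?e [N..<\<rho> + 1])"
    unfolding g_basis_def split by simp
  have all: "set (map ?e [0..<\<rho> + 1]) \<subseteq> carrier H"
    by auto
  have all': "set (map ?e [0..<N] @ map ?e [N..<\<rho> + 1]) \<subseteq> carrier H"
    using all unfolding split map_append .
  define g1 where "g1 = gram_schmidt_basis H (map ?e [0..<N])"
  obtain g2 where g2: "g = g1 @ g2"
    using gram_schmidt_basis_append[OF all'] unfolding gdef g1_def by blast
  have on: "orthonormal (g1 @ g2)"
    using gram_schmidt_basis(1)[OF all'] g2 gdef by simp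
  have "span (set (g1 @ g2)) = span (set (map ?e [0..<\<rho> + 1]))"
    using gram_schmidt_basis(2)[OF all'] g2 gdef unfolding split map_append by simp
  also have "set (map ?e [0..<\<rho> + 1]) = ?e ` {0..\<rho>}"
    by (simp add: atLeastLessThanSuc_atLeastAtMost del: upt_Suc)
  also have "span \<dots> = carrier H"
  proof
    show "span (?e ` {0..\<rho>}) \<subseteq> carrier H"
      by (rule span_is_subset2) auto
    show "carrier H \<subseteq> span (?e ` {0..\<rho>})"
    proof
      fix x assume "x \<in> carrier H"
      then obtain p where p: "p \<in> P" "x = \<C> p" by (rule carrier_cases)
      have "p = (\<Sum>j\<in>{0..\<rho>}. Poly_Mapping.single (k j) (Poly_Mapping.lookup p (k j)))"
      proof (rule poly_mapping_eqI)
        fix m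
        show "Poly_Mapping.lookup p m
            = Poly_Mapping.lookup (\<Sum>j\<in>{0..\<rho>}. Poly_Mapping.single (k j) (Poly_Mapping.lookup p (k j))) m"
        proof (cases "m \<in> k ` {0..\<rho>}")
          case True
          then obtain i where i: "i \<in> {0..\<rho>}" "m = k i" by blast
          have "k j = k i \<longleftrightarrow> j = i" if "j \<in> {0..\<rho>}" for j
            using inj_k i that by (auto dest: inj_onD)
          then show ?thesis
            using i by (simp add: lookup_sum lookup_single when_def)
        next
          case False
          then have "(\<Sum>j\<in>{0..\<rho>}. Poly_Mapping.lookup (Poly_Mapping.single (k j) (Poly_Mapping.lookup p (k j))) m) = 0"
            by (intro sum.neutral) (auto simp: lookup_single when_def)
          moreover have "Poly_Mapping.lookup p m = 0"
            using p(1) False unfolding mem_poly_space by blast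
          ultimately show ?thesis by (simp add: lookup_sum)
        qed
      qed
      then show "x \<in> span (?e ` {0..\<rho>})"
        using cls_sum_in_span[of "{0..\<rho>}" "\<lambda>j. Poly_Mapping.lookup p (k j)"] p by simp
    qed
  qed
  finally have full: "span (set (g1 @ g2)) = carrier H" .
  have "set (map ?e [0..<N]) = ?e ` \<Omega>"
    by (simp add: N lessThan_atLeast0)
  then have H0: "span (set g1) = H0_sub s k \<rho>"
    using gram_schmidt_basis(2)[of "map ?e [0..<N]"] all'
    unfolding g1_def H0_sub_def by simp
  note o = orthonormal_take_drop[OF on]
  have "length g1 = n\<^sub>0"
    using subdim_span_orthonormal[OF o(1)] by (simp add: H0_dim_def H0)
  moreover have "length g2 = i\<^sub>s"
    using subdim_span_orthonormal[OF o(2)] orth_compl_orthonormal[OF on full]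
    by (simp add: nsa_index_def H0)
  ultimately show ?thesis using that g2 on full H0 by blast
qed

lemma g_orthonormal: "orthonormal g" and g_full: "span (set g) = carrier H"
  and g_length: "length g = n\<^sub>0 + i\<^sub>s" and g_H0: "span (set (take n\<^sub>0 g)) = H0_sub s k \<rho>"
  by (rule g_basis_split; simp)+

lemma g_in_H0: "i < n\<^sub>0 \<Longrightarrow> g ! i \<in> H0_sub s k \<rho>"
proof -
  assume i: "i < n\<^sub>0"
  have "set (take n\<^sub>0 g) \<subseteq> carrier H"
    using orthonormal_carrier[OF g_orthonormal] set_take_subset by fast
  moreover have "take n\<^sub>0 g ! i \<in> set (take n\<^sub>0 g)"
    using i g_length by (intro nth_mem) simp
  ultimately have "take n\<^sub>0 g ! i \<in> H0_sub s k \<rho>"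
    unfolding g_H0[symmetric] using in_own_span by blast
  then show ?thesis using i by simp
qed

end

section \<open>Block matrices\<close>

lemma mat_adjoint_dim [simp]: "dim_row (mat_adjoint A) = dim_col A" "dim_col (mat_adjoint A) = dim_row A"
  by (simp_all add: mat_adjoint_def)

lemma mat_adjoint_carrier [simp]: "A \<in> carrier_mat n m \<Longrightarrow> mat_adjoint A \<in> carrier_mat m n"
  by auto

lemma mat_adjoint_index [simp]:
  "i < dim_col A \<Longrightarrow> j < dim_row A \<Longrightarrow> mat_adjoint A $$ (i, j) = cnj (A $$ (j, i))"
  by (simp add: mat_adjoint_def mat_of_rows_index)

lemma mat_adjoint_mult:
  assumes "dim_col A = dim_row B"
  shows "mat_adjoint (A * B) = mat_adjoint B * mat_adjoint (A :: complex mat)"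
  using assms by (intro eq_matI) (auto simp: scalar_prod_def mult.commute)

lemma mat_adjoint_add:
  "dim_row A = dim_row B \<Longrightarrow> dim_col A = dim_col B \<Longrightarrow>
    mat_adjoint (A + B) = mat_adjoint A + mat_adjoint (B :: complex mat)"
  by (intro eq_matI) auto

lemma mat_adjoint_adjoint [simp]: "mat_adjoint (mat_adjoint A) = (A :: complex mat)"
  by (intro eq_matI) auto

lemma mat_add_eq_add_iff:
  fixes X Y Z W :: "complex mat"
  assumes "X \<in> carrier_mat n m" "Y \<in> carrier_mat n m" "Z \<in> carrier_mat n m" "W \<in> carrier_mat n m"
  shows "X + Y = Z + W \<longleftrightarrow> W - Y = X - Z"
proof -
  have "a + b = c + d \<longleftrightarrow> d - b = a - c" for a b c d :: complex
    by (auto simp: algebra_simps)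
  then show ?thesis using assms by (auto simp: mat_eq_iff)
qed

lemma four_block_mat_eq_iff:
  assumes "A \<in> carrier_mat n n" "B \<in> carrier_mat n m" "C \<in> carrier_mat m n" "D \<in> carrier_mat m m"
    "A' \<in> carrier_mat n n" "B' \<in> carrier_mat n m" "C' \<in> carrier_mat m n" "D' \<in> carrier_mat m m"
  shows "four_block_mat A B C D = four_block_mat A' B' C' D' \<longleftrightarrow> A = A' \<and> B = B' \<and> C = C' \<and> D = D'"
proof
  assume eq: "four_block_mat A B C D = four_block_mat A' B' C' D'"
  have idx: "four_block_mat A B C D $$ (i, j) = four_block_mat A' B' C' D' $$ (i, j)" for i j
    by (simp add: eq)
  have "A $$ (i, j) = A' $$ (i, j)" if "i < n" "j < n" for i j
    using idx[of i j] that assms by simp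
  moreover have "B $$ (i, j) = B' $$ (i, j)" if "i < n" "j < m" for i j
    using idx[of i "n + j"] that assms by simp
  moreover have "C $$ (i, j) = C' $$ (i, j)" if "i < m" "j < n" for i j
    using idx[of "n + i" j] that assms by simp
  moreover have "D $$ (i, j) = D' $$ (i, j)" if "i < m" "j < m" for i j
    using idx[of "n + i" "n + j"] that assms by simp
  ultimately show "A = A' \<and> B = B' \<and> C = C' \<and> D = D'"
    using assms by (auto intro!: eq_matI)
qed simp

text \<open>
  The shape of a self-adjoint extension of \<open>M\<^sub>l\<close> in the basis adapted to \<open>H\<^sub>0\<close>: the operator \<open>M\<^sub>l\<close>
  determines the first column of blocks, self-adjointness the first row, and \<open>C\<close> is free.
\<close>

definition selfadjoint_block :: "complex mat \<Rightarrow> complex mat \<Rightarrow> complex mat \<Rightarrow> complex mat" where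
  "selfadjoint_block A B C = four_block_mat A (mat_adjoint B) B C"

lemma selfadjoint_block_carrier:
  "A \<in> carrier_mat n n \<Longrightarrow> C \<in> carrier_mat m m \<Longrightarrow> selfadjoint_block A B C \<in> carrier_mat (n + m) (n + m)"
  by (simp add: selfadjoint_block_def)

lemma mat_adjoint_selfadjoint_block:
  assumes "A \<in> carrier_mat n n" "B \<in> carrier_mat m n" "C \<in> carrier_mat m m"
    "mat_adjoint A = A" "mat_adjoint C = C"
  shows "mat_adjoint (selfadjoint_block A B C) = selfadjoint_block A B C"
proof (rule eq_matI)
  fix i j assume "i < dim_row (selfadjoint_block A B C)" "j < dim_col (selfadjoint_block A B C)"
  then have ij: "i < n + m" "j < n + m" using assms by (simp_all add: selfadjoint_block_def)
  have "cnj (A $$ (j, i)) = A $$ (i, j)" if "i < n" "j < n" for i j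
    using mat_adjoint_index[of i A j] that assms by simp
  moreover have "cnj (C $$ (j, i)) = C $$ (i, j)" if "i < m" "j < m" for i j
    using mat_adjoint_index[of i C j] that assms by simp
  ultimately show "mat_adjoint (selfadjoint_block A B C) $$ (i, j) = selfadjoint_block A B C $$ (i, j)"
    using ij assms(1-3) by (simp add: selfadjoint_block_def)
qed (use assms in \<open>auto simp: selfadjoint_block_def\<close>)

text \<open>
  Comparison of the four blocks of the two products. The equation of the lower left blocks is the
  adjoint of the equation of the upper right blocks, so three conditions remain.
\<close>

lemma selfadjoint_block_commute_iff:
  assumes A: "A1 \<in> carrier_mat n n" "A2 \<in> carrier_mat n n"
    and B: "B1 \<in> carrier_mat m n" "B2 \<in> carrier_mat m n"
    and C: "C1 \<in> carrier_mat m m" "C2 \<in> carrier_mat m m"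
    and adj: "mat_adjoint A1 = A1" "mat_adjoint A2 = A2" "mat_adjoint C1 = C1" "mat_adjoint C2 = C2"
  shows "selfadjoint_block A1 B1 C1 * selfadjoint_block A2 B2 C2
      = selfadjoint_block A2 B2 C2 * selfadjoint_block A1 B1 C1 \<longleftrightarrow>
    A1 * A2 + mat_adjoint B1 * B2 = A2 * A1 + mat_adjoint B2 * B1 \<and>
    mat_adjoint B2 * C1 - mat_adjoint B1 * C2 = A1 * mat_adjoint B2 - A2 * mat_adjoint B1 \<and>
    C1 * C2 - C2 * C1 = B2 * mat_adjoint B1 - B1 * mat_adjoint B2"
proof -
  note dims = A[THEN carrier_matD(1)] A[THEN carrier_matD(2)] B[THEN carrier_matD(1)]
    B[THEN carrier_matD(2)] C[THEN carrier_matD(1)] C[THEN carrier_matD(2)]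
  have lower: "B1 * A2 + C1 * B2 = B2 * A1 + C2 * B1"
    if upper: "A1 * mat_adjoint B2 + mat_adjoint B1 * C2 = A2 * mat_adjoint B1 + mat_adjoint B2 * C1"
  proof -
    have "B1 * A2 + C1 * B2 = mat_adjoint (A2 * mat_adjoint B1 + mat_adjoint B2 * C1)"
      by (simp add: mat_adjoint_add mat_adjoint_mult dims adj)
    also have "\<dots> = mat_adjoint (A1 * mat_adjoint B2 + mat_adjoint B1 * C2)"
      by (simp add: upper)
    also have "\<dots> = B2 * A1 + C2 * B1"
      by (simp add: mat_adjoint_add mat_adjoint_mult dims adj)
    finally show ?thesis .
  qed
  have prod: "selfadjoint_block A1 B1 C1 * selfadjoint_block A2 B2 C2
      = four_block_mat (A1 * A2 + mat_adjoint B1 * B2) (A1 * mat_adjoint B2 + mat_adjoint B1 * C2)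
          (B1 * A2 + C1 * B2) (B1 * mat_adjoint B2 + C1 * C2)"
    "selfadjoint_block A2 B2 C2 * selfadjoint_block A1 B1 C1
      = four_block_mat (A2 * A1 + mat_adjoint B2 * B1) (A2 * mat_adjoint B1 + mat_adjoint B2 * C1)
          (B2 * A1 + C2 * B1) (B2 * mat_adjoint B1 + C2 * C1)"
    unfolding selfadjoint_block_def
    by (rule mult_four_block_mat; use A B C in auto)+
  have blocks: "selfadjoint_block A1 B1 C1 * selfadjoint_block A2 B2 C2
      = selfadjoint_block A2 B2 C2 * selfadjoint_block A1 B1 C1 \<longleftrightarrow>
    A1 * A2 + mat_adjoint B1 * B2 = A2 * A1 + mat_adjoint B2 * B1 \<and>
    A1 * mat_adjoint B2 + mat_adjoint B1 * C2 = A2 * mat_adjoint B1 + mat_adjoint B2 * C1 \<and>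
    B1 * A2 + C1 * B2 = B2 * A1 + C2 * B1 \<and>
    B1 * mat_adjoint B2 + C1 * C2 = B2 * mat_adjoint B1 + C2 * C1"
    unfolding prod by (rule four_block_mat_eq_iff[of _ n _ m]) (use A B C in auto)
  have upper: "A1 * mat_adjoint B2 + mat_adjoint B1 * C2 = A2 * mat_adjoint B1 + mat_adjoint B2 * C1
      \<longleftrightarrow> mat_adjoint B2 * C1 - mat_adjoint B1 * C2 = A1 * mat_adjoint B2 - A2 * mat_adjoint B1"
    by (rule mat_add_eq_add_iff[of _ n m]) (use A B C in auto)
  have "B1 * mat_adjoint B2 + C1 * C2 = C1 * C2 + B1 * mat_adjoint B2"
    "B2 * mat_adjoint B1 + C2 * C1 = C2 * C1 + B2 * mat_adjoint B1"
    by (rule comm_add_mat[of _ m m]; use B C in auto)+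
  moreover have "C1 * C2 + B1 * mat_adjoint B2 = C2 * C1 + B2 * mat_adjoint B1
      \<longleftrightarrow> B2 * mat_adjoint B1 - B1 * mat_adjoint B2 = C1 * C2 - C2 * C1"
    by (rule mat_add_eq_add_iff[of _ m m]) (use B C in auto)
  ultimately have diag: "B1 * mat_adjoint B2 + C1 * C2 = B2 * mat_adjoint B1 + C2 * C1
      \<longleftrightarrow> C1 * C2 - C2 * C1 = B2 * mat_adjoint B1 - B1 * mat_adjoint B2"
    by (simp only: eq_commute[of "C1 * C2 - C2 * C1"])
  show ?thesis
    unfolding blocks upper[symmetric] diag[symmetric] using lower by blast
qed

section \<open>Operators and their matrices\<close>

context ip_space
begin

definition matrix_of :: "'v list \<Rightarrow> ('v \<Rightarrow> 'v) \<Rightarrow> complex mat" where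
  "matrix_of gs T = Matrix.mat (length gs) (length gs) (\<lambda>(j, l). ip V (T (gs ! l)) (gs ! j))"

definition operator_of :: "'v list \<Rightarrow> complex mat \<Rightarrow> 'v \<Rightarrow> 'v" where
  "operator_of gs X x = (\<Oplus>\<^bsub>V\<^esub> j\<in>{..<length gs}.
     (\<Sum>l<length gs. X $$ (j, l) * ip V x (gs ! l)) \<odot>\<^bsub>V\<^esub> gs ! j)"

lemma matrix_of_mult:
  assumes on: "orthonormal gs" and full: "span (set gs) = carrier V"
    and T: "T \<in> module_hom class_ring V V" and U: "U \<in> module_hom class_ring V V"
  shows "matrix_of gs (\<lambda>x. T (U x)) = matrix_of gs T * matrix_of gs U"
proof (rule eq_matI)
  note c [simp] = orthonormal_carrier[OF on]
  fix j l
  assume "j < dim_row (matrix_of gs T * matrix_of gs U)" "l < dim_col (matrix_of gs T * matrix_of gs U)"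
  then have jl: "j < length gs" "l < length gs" by (simp_all add: matrix_of_def)
  define x where "x = U (gs ! l)"
  have x: "x \<in> carrier V" "proj gs x = x"
    using in_span_orthonormal_iff[OF on, of x] full jl hom_closed[OF U] by (simp_all add: x_def)
  have Tg: "T (gs ! m) \<in> carrier V" if "m < length gs" for m
    using that hom_closed[OF T] by simp
  have "T (proj gs x) = (\<Oplus>\<^bsub>V\<^esub> m\<in>{..<length gs}. ip V x (gs ! m) \<odot>\<^bsub>V\<^esub> T (gs ! m))"
    unfolding proj_def
    by (subst hom_finsum[OF T]) (auto simp: hom_smult[OF T] Tg intro!: finsum_cong')
  then have "ip V (T x) (gs ! j) = (\<Sum>m<length gs. ip V x (gs ! m) * ip V (T (gs ! m)) (gs ! j))"
    using x(2) jl by (simp add: Tg)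
  then show "matrix_of gs (\<lambda>x. T (U x)) $$ (j, l) = (matrix_of gs T * matrix_of gs U) $$ (j, l)"
    using jl by (simp add: matrix_of_def scalar_prod_def x_def lessThan_atLeast0 mult.commute)
qed (simp_all add: matrix_of_def)

lemma operator_of_closed [simp]: "set gs \<subseteq> carrier V \<Longrightarrow> operator_of gs X x \<in> carrier V"
  by (simp add: operator_of_def)

lemma ip_operator_of:
  assumes "orthonormal gs" "j < length gs"
  shows "ip V (operator_of gs X x) (gs ! j) = (\<Sum>l<length gs. X $$ (j, l) * ip V x (gs ! l))"
  using assms orthonormal_carrier[OF assms(1)]
  by (simp add: operator_of_def orthonormal_ip if_distrib cong: if_cong)

lemma ip_operator_of_nth:
  assumes "orthonormal gs" "j < length gs" "l < length gs"
  shows "ip V (operator_of gs X (gs ! l)) (gs ! j) = X $$ (j, l)"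
  using assms by (simp add: ip_operator_of orthonormal_ip if_distrib cong: if_cong)

lemma operator_of_hom:
  assumes on: "orthonormal gs" and full: "span (set gs) = carrier V"
  shows "operator_of gs X \<in> module_hom class_ring V V"
proof (rule module_homI)
  note c [simp] = orthonormal_carrier[OF on]
  fix x y assume "x \<in> carrier V" "y \<in> carrier V"
  then show "operator_of gs X (x \<oplus>\<^bsub>V\<^esub> y) = operator_of gs X x \<oplus>\<^bsub>V\<^esub> operator_of gs X y"
    by (intro orthonormal_ext[OF on]) (simp_all add: full ip_operator_of[OF on] distrib_left sum.distrib)
next
  note c [simp] = orthonormal_carrier[OF on]
  fix a x assume "x \<in> carrier V"
  then show "operator_of gs X (a \<odot>\<^bsub>V\<^esub> x) = a \<odot>\<^bsub>V\<^esub> operator_of gs X x"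
    by (intro orthonormal_ext[OF on]) (simp_all add: full ip_operator_of[OF on] sum_distrib_left mult_ac)
qed (simp add: orthonormal_carrier[OF on])

lemma operator_of_self_adjoint:
  assumes on: "orthonormal gs" and full: "span (set gs) = carrier V"
    and X: "X \<in> carrier_mat (length gs) (length gs)" "mat_adjoint X = X"
  shows "self_adjoint_op V (operator_of gs X)"
  unfolding self_adjoint_op_def
proof (intro conjI ballI operator_of_hom[OF on full])
  note c [simp] = orthonormal_carrier[OF on]
  fix x y assume x: "x \<in> carrier V" and y: "y \<in> carrier V"
  have Xc: "cnj (X $$ (j, l)) = X $$ (l, j)" if "j < length gs" "l < length gs" for j l
    using mat_adjoint_index[of l X j] that X by simp
  have "ip V (operator_of gs X x) y
      = (\<Sum>j<length gs. \<Sum>l<length gs. X $$ (j, l) * ip V x (gs ! l) * cnj (ip V y (gs ! j)))"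
    using x y by (subst parseval[OF on]) (simp_all add: full ip_operator_of[OF on] sum_distrib_right)
  also have "\<dots> = (\<Sum>l<length gs. \<Sum>j<length gs. X $$ (j, l) * ip V x (gs ! l) * cnj (ip V y (gs ! j)))"
    by (rule sum.swap)
  also have "\<dots> = ip V x (operator_of gs X y)"
    using x y by (subst parseval[OF on]) (simp_all add: full ip_operator_of[OF on] sum_distrib_left Xc mult_ac)
  finally show "ip V (operator_of gs X x) y = ip V x (operator_of gs X y)" .
qed

lemma operator_of_mult:
  assumes on: "orthonormal gs" and full: "span (set gs) = carrier V" and x: "x \<in> carrier V"
    and X: "X \<in> carrier_mat (length gs) (length gs)" and Y: "Y \<in> carrier_mat (length gs) (length gs)"
  shows "operator_of gs X (operator_of gs Y x) = operator_of gs (X * Y) x"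
proof (rule orthonormal_ext[OF on])
  note c [simp] = orthonormal_carrier[OF on]
  fix j assume j: "j < length gs"
  have "ip V (operator_of gs X (operator_of gs Y x)) (gs ! j)
      = (\<Sum>l<length gs. \<Sum>m<length gs. X $$ (j, l) * Y $$ (l, m) * ip V x (gs ! m))"
    using j by (simp add: ip_operator_of[OF on] sum_distrib_left mult.assoc)
  also have "\<dots> = (\<Sum>m<length gs. \<Sum>l<length gs. X $$ (j, l) * Y $$ (l, m) * ip V x (gs ! m))"
    by (rule sum.swap)
  also have "\<dots> = ip V (operator_of gs (X * Y) x) (gs ! j)"
    using j X Y by (simp add: ip_operator_of[OF on] scalar_prod_def lessThan_atLeast0 sum_distrib_right)
  finally show "ip V (operator_of gs X (operator_of gs Y x)) (gs ! j) = ip V (operator_of gs (X * Y) x) (gs ! j)" .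
qed (simp_all add: orthonormal_carrier[OF on] full)

end

section \<open>Canonical solutions and commuting extensions\<close>

context truncated_moments
begin

abbreviation A where "A \<equiv> A_mat s k \<rho>"
abbreviation B where "B \<equiv> B_mat s k \<rho>"

lemma A_carrier: "A l \<in> carrier_mat n\<^sub>0 n\<^sub>0" and B_carrier: "B l \<in> carrier_mat i\<^sub>s n\<^sub>0"
  by (simp_all add: A_mat_def B_mat_def)

lemma g_carrier: "set g \<subseteq> carrier H"
  by (rule orthonormal_carrier[OF g_orthonormal])

lemma A_adjoint: "l \<in> {1, 2} \<Longrightarrow> mat_adjoint (A l) = A l"
proof (rule eq_matI)
  fix i j assume l: "l \<in> {1, 2}" and "i < dim_row (A l)" "j < dim_col (A l)"
  then have ij: "i < n\<^sub>0" "j < n\<^sub>0" by (simp_all add: A_mat_def)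
  note gi = g_in_H0[OF ij(1)] and gj = g_in_H0[OF ij(2)]
  have "cnj (ip H (M_op s k \<rho> l (g ! i)) (g ! j)) = ip H (g ! j) (M_op s k \<rho> l (g ! i))"
    using ip_cnj[OF M_op_closed[OF l gi] H0_carrier[OF gj]] by simp
  also have "\<dots> = ip H (M_op s k \<rho> l (g ! j)) (g ! i)"
    by (rule M_op_symmetric[OF l gj gi, symmetric])
  finally show "mat_adjoint (A l) $$ (i, j) = A l $$ (i, j)"
    using ij by (simp add: A_mat_def)
qed (simp_all add: A_mat_def)

text \<open>
  The columns with index below \<open>dim H\<^sub>0\<close> are those of \<open>M\<^sub>l\<close>, because \<open>T\<close> extends it; symmetry of \<open>T\<close>
  gives the other entries outside the lower right block.
\<close>

lemma matrix_of_extension: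
  assumes T: "self_adjoint_op H T" and ext: "\<forall>x\<in>H0_sub s k \<rho>. T x = M_op s k \<rho> l x"
  obtains C where "C \<in> carrier_mat i\<^sub>s i\<^sub>s" "hermitian_mat C"
    "matrix_of g T = selfadjoint_block (A l) (B l) C"
proof -
  define C where "C = Matrix.mat i\<^sub>s i\<^sub>s (\<lambda>(j, m). ip H (T (g ! (n\<^sub>0 + m))) (g ! (n\<^sub>0 + j)))"
  have c: "C \<in> carrier_mat i\<^sub>s i\<^sub>s" by (simp add: C_def)
  have sym: "ip H (T (g ! m)) (g ! j) = cnj (ip H (T (g ! j)) (g ! m))"
    if "m < n\<^sub>0 + i\<^sub>s" "j < n\<^sub>0 + i\<^sub>s" for m j
  proof -
    have gc: "g ! m \<in> carrier H" "g ! j \<in> carrier H"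
      using that g_carrier g_length by simp_all
    show ?thesis
      unfolding self_adjoint_ip[OF T gc]
      by (rule ip_cnj[OF hom_closed[OF self_adjoint_hom[OF T] gc(2)] gc(1)])
  qed
  have "mat_adjoint C = C"
  proof (rule eq_matI)
    fix i j assume "i < dim_row C" "j < dim_col C"
    then have "i < i\<^sub>s" "j < i\<^sub>s" by (simp_all add: C_def)
    then show "mat_adjoint C $$ (i, j) = C $$ (i, j)"
      using sym[of "n\<^sub>0 + j" "n\<^sub>0 + i"] by (simp add: C_def)
  qed (simp_all add: C_def)
  then have herm: "hermitian_mat C" using c by (simp add: hermitian_mat_def)
  have "matrix_of g T = selfadjoint_block (A l) (B l) C"
  proof (rule eq_matI)
    fix j m assume "j < dim_row (selfadjoint_block (A l) (B l) C)" "m < dim_col (selfadjoint_block (A l) (B l) C)"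
    then have jm: "j < n\<^sub>0 + i\<^sub>s" "m < n\<^sub>0 + i\<^sub>s"
      using A_carrier[of l] c by (simp_all add: selfadjoint_block_def)
    have Tg: "T (g ! i) = M_op s k \<rho> l (g ! i)" if "i < n\<^sub>0" for i
      using ext g_in_H0[OF that] by blast
    consider "m < n\<^sub>0" "j < n\<^sub>0" | "m < n\<^sub>0" "\<not> j < n\<^sub>0" | "\<not> m < n\<^sub>0" "j < n\<^sub>0" | "\<not> m < n\<^sub>0" "\<not> j < n\<^sub>0"
      by blast
    then show "matrix_of g T $$ (j, m) = selfadjoint_block (A l) (B l) C $$ (j, m)"
      by cases (use jm sym[OF jm(2,1)] in \<open>simp_all add: matrix_of_def g_length selfadjoint_block_def
          A_mat_def B_mat_def C_def Tg\<close>)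
  qed (use A_carrier[of l] c in \<open>simp_all add: matrix_of_def g_length selfadjoint_block_def\<close>)
  with c herm show ?thesis by (rule that)
qed

text \<open>
  The operator agrees with \<open>M\<^sub>l\<close> on the basis elements in \<open>H\<^sub>0\<close>, and the vectors on which two linear
  maps agree form a subspace.
\<close>

lemma extension_of_matrix:
  assumes l: "l \<in> {1, 2}" and C: "C \<in> carrier_mat i\<^sub>s i\<^sub>s" "hermitian_mat C"
  defines "T \<equiv> operator_of g (selfadjoint_block (A l) (B l) C)"
  shows "self_adjoint_op H T" "x \<in> H0_sub s k \<rho> \<Longrightarrow> T x = M_op s k \<rho> l x"
proof -
  let ?X = "selfadjoint_block (A l) (B l) C"
  have adj: "mat_adjoint C = C" using C by (simp add: hermitian_mat_def)
  show sa: "self_adjoint_op H T"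
    unfolding T_def
    by (rule operator_of_self_adjoint[OF g_orthonormal g_full])
       (simp_all add: g_length selfadjoint_block_carrier[OF A_carrier C(1)]
          mat_adjoint_selfadjoint_block[OF A_carrier B_carrier C(1) A_adjoint[OF l] adj])
  note hom = self_adjoint_hom[OF sa]
  note M = M_op_closed[OF l] M_op_smult[OF l] M_op_add[OF l]
  have gen: "T (g ! m) = M_op s k \<rho> l (g ! m)" if m: "m < n\<^sub>0" for m
  proof (rule orthonormal_ext[OF g_orthonormal])
    fix j assume j: "j < length g"
    show "ip H (T (g ! m)) (g ! j) = ip H (M_op s k \<rho> l (g ! m)) (g ! j)"
      using j m A_carrier[of l] B_carrier[of l] C(1) g_length unfolding T_def
      by (cases "j < n\<^sub>0") (simp_all add: ip_operator_of_nth[OF g_orthonormal] selfadjoint_block_def A_mat_def B_mat_def)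
  qed (use M g_in_H0[OF m] hom_closed[OF hom] H0_carrier in \<open>simp_all add: g_full\<close>)
  have "submodule class_ring {x \<in> H0_sub s k \<rho>. T x = M_op s k \<rho> l x} H"
  proof (rule submoduleI)
    have z: "\<zero>\<^bsub>H\<^esub> \<in> H0_sub s k \<rho>" by (rule submodule.zero_closed[OF H0_submodule])
    have "M_op s k \<rho> l \<zero>\<^bsub>H\<^esub> = M_op s k \<rho> l (0 \<odot>\<^bsub>H\<^esub> \<zero>\<^bsub>H\<^esub>)" by simp
    also have "\<dots> = 0 \<odot>\<^bsub>H\<^esub> M_op s k \<rho> l \<zero>\<^bsub>H\<^esub>" by (rule M(2)[OF z])
    also have "\<dots> = 0 \<odot>\<^bsub>H\<^esub> T \<zero>\<^bsub>H\<^esub>"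
      using M(1)[OF z] hom_closed[OF hom, of "\<zero>\<^bsub>H\<^esub>"] by (intro ip_ext) simp_all
    also have "\<dots> = T (0 \<odot>\<^bsub>H\<^esub> \<zero>\<^bsub>H\<^esub>)" by (rule hom_smult[OF hom, symmetric]) simp
    finally show "\<zero>\<^bsub>H\<^esub> \<in> {x \<in> H0_sub s k \<rho>. T x = M_op s k \<rho> l x}" using z by simp
  qed (auto simp: M hom_add[OF hom] hom_smult[OF hom] H0_carrier
      intro: submodule.m_closed[OF H0_submodule] subspace_smult[OF H0_submodule])
  moreover have "set (take n\<^sub>0 g) \<subseteq> {x \<in> H0_sub s k \<rho>. T x = M_op s k \<rho> l x}"
    using gen g_in_H0 g_length by (auto simp: in_set_conv_nth)
  ultimately have "H0_sub s k \<rho> \<subseteq> {x \<in> H0_sub s k \<rho>. T x = M_op s k \<rho> l x}"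
    unfolding g_H0[symmetric] by (intro span_minimal)
  then show "x \<in> H0_sub s k \<rho> \<Longrightarrow> T x = M_op s k \<rho> l x" by blast
qed

text \<open>
  Starting from \<open>1\<close>, the monomial \<open>t\<^sup>m\<close> is reached by multiplying with one variable at a time, and all
  intermediate monomials have degree below \<open>r\<close>. So each step is an application of \<open>T\<^sub>1\<close> or \<open>T\<^sub>2\<close>, which
  moves to the eigenvector and contributes its eigenvalue.
\<close>

lemma ip_monomial_eigenvector:
  assumes T1: "self_adjoint_op H T1" "\<forall>x\<in>H0_sub s k \<rho>. T1 x = M_op s k \<rho> 1 x"
    and T2: "self_adjoint_op H T2" "\<forall>x\<in>H0_sub s k \<rho>. T2 x = M_op s k \<rho> 2 x"
    and u: "u \<in> carrier H"
    and eig: "T1 u = complex_of_real a \<odot>\<^bsub>H\<^esub> u" "T2 u = complex_of_real b \<odot>\<^bsub>H\<^esub> u"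
    and m: "m \<in> K_deg r"
  shows "ip H (\<C> (mon m)) u = complex_of_real (a ^ fst m * b ^ snd m) * ip H (\<C> 1) u"
  using m
proof (induction "fst m + snd m" arbitrary: m)
  case 0
  then have "m = 0" by (simp add: prod_eq_iff)
  then show ?case by simp
next
  case (Suc n)
  have step: "ip H (\<C> (mon (m' + unit_index l))) u = complex_of_real c * ip H (\<C> (mon m')) u"
    if T: "self_adjoint_op H T" "\<forall>x\<in>H0_sub s k \<rho>. T x = M_op s k \<rho> l x"
      and l: "l \<in> {1, 2}" and c: "T u = complex_of_real c \<odot>\<^bsub>H\<^esub> u" and m': "m' \<in> K_deg (r - 1)"
    for T l c m'
  proof -
    note M = M_op_monomial[OF l m']
    have e: "\<C> (mon m') \<in> carrier H" by (rule H0_carrier[OF M(1)])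
    have "ip H (\<C> (mon (m' + unit_index l))) u = ip H (T (\<C> (mon m'))) u"
      using T(2) M by simp
    also have "\<dots> = ip H (\<C> (mon m')) (T u)"
      by (rule self_adjoint_ip[OF T(1) e u])
    finally show ?thesis using e u by (simp add: c)
  qed
  consider x y where "m = (Suc x, y)" | x y where "m = (x, Suc y)"
    using Suc(2) by (cases m; cases "fst m"; cases "snd m") auto
  then show ?case
  proof cases
    case (1 x y)
    then have m: "m = (x, y) + unit_index 1" "(x, y) \<in> K_deg (r - 1)" "(x, y) \<in> K_deg r" "n = x + y"
      using Suc by (auto simp: unit_index_def K_deg_def)
    show ?thesis
      using step[OF T1 _ eig(1) m(2)] Suc.hyps(1)[of "(x, y)"] m(3,4) 1 unfolding m(1)[symmetric]
      by simp
  next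
    case (2 x y)
    then have m: "m = (x, y) + unit_index 2" "(x, y) \<in> K_deg (r - 1)" "(x, y) \<in> K_deg r" "n = x + y"
      using Suc by (auto simp: unit_index_def K_deg_def)
    show ?thesis
      using step[OF T2 _ eig(2) m(2)] Suc.hyps(1)[of "(x, y)"] m(3,4) 2 unfolding m(1)[symmetric]
      by simp
  qed
qed

text \<open>
  The measure has mass \<open>\<bar>\<langle>1, u\<^sub>i\<rangle>\<bar>\<^sup>2\<close> at the joint eigenvalue \<open>(a\<^sub>i, b\<^sub>i)\<close> of \<open>u\<^sub>i\<close>. Every exponent of
  the moment problem is a sum \<open>x + y\<close> with \<open>x, y \<in> K\<^sub>r\<close>, and its moment is \<open>\<langle>t\<^sup>x, t\<^sup>y\<rangle>\<close>; expanding
  this in the eigenbasis gives the integral.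
\<close>

lemma canonical_solution_exists:
  assumes T1: "self_adjoint_op H T1" "\<forall>x\<in>H0_sub s k \<rho>. T1 x = M_op s k \<rho> 1 x"
    and T2: "self_adjoint_op H T2" "\<forall>x\<in>H0_sub s k \<rho>. T2 x = M_op s k \<rho> 2 x"
    and comm: "commuting_ops H T1 T2"
  shows "\<exists>\<mu>. canonical_solution s k \<rho> \<mu>"
proof -
  obtain us a b where us: "orthonormal us" "span (set us) = carrier H"
    and eig: "\<And>j. j < length us \<Longrightarrow> T1 (us ! j) = complex_of_real (a j) \<odot>\<^bsub>H\<^esub> us ! j"
      "\<And>j. j < length us \<Longrightarrow> T2 (us ! j) = complex_of_real (b j) \<odot>\<^bsub>H\<^esub> us ! j"
    using joint_eigenbasis[OF T1(1) T2(1) comm g_orthonormal g_full] by metis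
  define p where "p j = (a j, b j)" for j
  define w where "w j = (cmod (ip H (\<C> 1) (us ! j)))\<^sup>2" for j
  define \<mu> where "\<mu> = point_masses (length us) w p"
  have w0: "0 \<le> w j" for j by (simp add: w_def)
  note usc = orthonormal_carrier[OF us(1)]
  have zero: "(0, 0) \<in> K_deg r" by (simp add: K_deg_def)
  have one: "\<C> 1 \<in> carrier H"
    using cls_monomial_in[OF zero, of 1] by (simp add: zero_prod_def[symmetric])
  have joint: "joint_spectral_measure H (eigen_measure us p) T1 T2"
    unfolding p_def by (rule joint_spectral_measure_eigen_measure[OF us T1(1) T2(1) eig])
  have "complex_of_real (measure \<mu> \<delta>) = ip H (eigen_measure us p \<delta> (\<C> 1)) (\<C> 1)"
    if "\<delta> \<in> sets borel" for \<delta>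
    unfolding \<mu>_def measure_point_masses[OF w0 that] ip_eigen_measure_self[OF usc one] w_def ..
  moreover have "moment_solution s (k ` {0..\<rho>}) \<mu>"
    unfolding moment_solution_def image_k
  proof (intro conjI ballI)
    show "sets \<mu> = sets borel" by (simp add: \<mu>_def)
    fix m :: "nat \<times> nat"
    assume "m \<in> {x + y | x y. x \<in> K_deg r \<and> y \<in> K_deg r}"
    then obtain x y where xy: "m = x + y" "x \<in> K_deg r" "y \<in> K_deg r" by blast
    have f: "(\<lambda>t :: real \<times> real. fst t ^ fst m * snd t ^ snd m) \<in> borel_measurable borel"
      by (simp add: borel_prod[symmetric])
    show "integrable \<mu> (\<lambda>t. fst t ^ fst m * snd t ^ snd m)"
      unfolding \<mu>_def by (rule integral_point_masses(1)[OF w0 f])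
    have ev: "ip H (\<C> (mon z)) (us ! i) = complex_of_real (a i ^ fst z * b i ^ snd z) * ip H (\<C> 1) (us ! i)"
      if "z \<in> K_deg r" "i < length us" for z i
      using that usc by (intro ip_monomial_eigenvector[OF T1 T2 _ eig]) simp_all
    have "complex_of_real (s m) = ip H (\<C> (mon x)) (\<C> (mon y))"
      using xy by (simp add: ip_H form_monomial image_k)
    also have "\<dots> = (\<Sum>i<length us. ip H (\<C> (mon x)) (us ! i) * cnj (ip H (\<C> (mon y)) (us ! i)))"
      using xy by (intro parseval[OF us(1)]) (simp_all add: us(2))
    also have "\<dots> = (\<Sum>i<length us. complex_of_real (w i * (fst (p i) ^ fst m * snd (p i) ^ snd m)))"
    proof (intro sum.cong refl)
      fix i assume "i \<in> {..<length us}"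
      then have "ip H (\<C> (mon x)) (us ! i) * cnj (ip H (\<C> (mon y)) (us ! i))
          = complex_of_real (a i ^ fst x * b i ^ snd x) * complex_of_real (a i ^ fst y * b i ^ snd y)
            * (ip H (\<C> 1) (us ! i) * cnj (ip H (\<C> 1) (us ! i)))"
        using xy by (simp add: ev)
      also have "\<dots> = complex_of_real ((a i ^ fst x * b i ^ snd x) * (a i ^ fst y * b i ^ snd y) * w i)"
        by (simp only: w_def complex_norm_square[symmetric] of_real_mult)
      also have "(a i ^ fst x * b i ^ snd x) * (a i ^ fst y * b i ^ snd y) * w i
          = w i * (fst (p i) ^ fst m * snd (p i) ^ snd m)"
        by (simp add: xy(1) p_def power_add)
      finally show "ip H (\<C> (mon x)) (us ! i) * cnj (ip H (\<C> (mon y)) (us ! i))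
          = complex_of_real (w i * (fst (p i) ^ fst m * snd (p i) ^ snd m))" .
    qed
    also have "\<dots> = complex_of_real (\<integral>t. fst t ^ fst m * snd t ^ snd m \<partial>\<mu>)"
      unfolding \<mu>_def integral_point_masses(2)[OF w0 f] by simp
    finally show "(\<integral>t. fst t ^ fst m * snd t ^ snd m \<partial>\<mu>) = s m"
      by (simp only: of_real_eq_iff)
  qed
  ultimately have "canonical_solution s k \<rho> \<mu>"
    unfolding canonical_solution_def M_dom_eq
    using T1 T2 comm joint by blast
  then show ?thesis by blast
qed

text \<open>
  Commuting self-adjoint extensions of \<open>M\<^sub>1\<close> and \<open>M\<^sub>2\<close> correspond to pairs of Hermitian lower right
  blocks for which the block matrices commute.
\<close>

theorem canonical_solution_iff:
  assumes AB: "A 1 * A 2 + mat_adjoint (B 1) * B 2 = A 2 * A 1 + mat_adjoint (B 2) * B 1"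
  shows "(\<exists>\<mu>. canonical_solution s k \<rho> \<mu>) \<longleftrightarrow>
    (\<exists>C1 C2. C1 \<in> carrier_mat i\<^sub>s i\<^sub>s \<and> C2 \<in> carrier_mat i\<^sub>s i\<^sub>s \<and>
       hermitian_mat C1 \<and> hermitian_mat C2 \<and>
       mat_adjoint (B 2) * C1 - mat_adjoint (B 1) * C2 = A 1 * mat_adjoint (B 2) - A 2 * mat_adjoint (B 1) \<and>
       C1 * C2 - C2 * C1 = B 2 * mat_adjoint (B 1) - B 1 * mat_adjoint (B 2))"
    (is "?L \<longleftrightarrow> (\<exists>C1 C2. ?R C1 C2)")
proof
  have commute_iff: "selfadjoint_block (A 1) (B 1) C1 * selfadjoint_block (A 2) (B 2) C2
      = selfadjoint_block (A 2) (B 2) C2 * selfadjoint_block (A 1) (B 1) C1 \<longleftrightarrow> ?R C1 C2"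
    if "C1 \<in> carrier_mat i\<^sub>s i\<^sub>s" "C2 \<in> carrier_mat i\<^sub>s i\<^sub>s" "hermitian_mat C1" "hermitian_mat C2" for C1 C2
    using selfadjoint_block_commute_iff[OF A_carrier A_carrier B_carrier B_carrier that(1,2) A_adjoint A_adjoint]
      AB that by (simp add: hermitian_mat_def)
  {
    assume ?L
    then obtain T1 T2 where T: "self_adjoint_op H T1" "self_adjoint_op H T2" "commuting_ops H T1 T2"
      "\<forall>x\<in>H0_sub s k \<rho>. T1 x = M_op s k \<rho> 1 x" "\<forall>x\<in>H0_sub s k \<rho>. T2 x = M_op s k \<rho> 2 x"
      unfolding canonical_solution_def M_dom_eq by blast
    obtain C1 where C1: "C1 \<in> carrier_mat i\<^sub>s i\<^sub>s" "hermitian_mat C1"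
      "matrix_of g T1 = selfadjoint_block (A 1) (B 1) C1"
      by (rule matrix_of_extension[OF T(1,4)])
    obtain C2 where C2: "C2 \<in> carrier_mat i\<^sub>s i\<^sub>s" "hermitian_mat C2"
      "matrix_of g T2 = selfadjoint_block (A 2) (B 2) C2"
      by (rule matrix_of_extension[OF T(2,5)])
    note h = self_adjoint_hom[OF T(1)] self_adjoint_hom[OF T(2)]
    have "matrix_of g (\<lambda>x. T1 (T2 x)) = matrix_of g (\<lambda>x. T2 (T1 x))"
      using T(3) g_carrier by (intro eq_matI) (simp_all add: matrix_of_def commuting_ops_def)
    then have "matrix_of g T1 * matrix_of g T2 = matrix_of g T2 * matrix_of g T1"
      unfolding matrix_of_mult[OF g_orthonormal g_full h] matrix_of_mult[OF g_orthonormal g_full h(2,1)] .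
    then have "?R C1 C2"
      unfolding C1(3) C2(3) using commute_iff[OF C1(1) C2(1) C1(2) C2(2)] by blast
    then show "\<exists>C1 C2. ?R C1 C2" by blast
  next
    assume "\<exists>C1 C2. ?R C1 C2"
    then obtain C1 C2 where R: "?R C1 C2" by blast
    then have C: "C1 \<in> carrier_mat i\<^sub>s i\<^sub>s" "C2 \<in> carrier_mat i\<^sub>s i\<^sub>s" "hermitian_mat C1" "hermitian_mat C2"
      by auto
    let ?X1 = "selfadjoint_block (A 1) (B 1) C1" and ?X2 = "selfadjoint_block (A 2) (B 2) C2"
    have X: "?X1 \<in> carrier_mat (length g) (length g)" "?X2 \<in> carrier_mat (length g) (length g)"
      unfolding g_length using selfadjoint_block_carrier[OF A_carrier] C by auto
    have "?X1 * ?X2 = ?X2 * ?X1" using commute_iff[OF C] R by blast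
    then have "commuting_ops H (operator_of g ?X1) (operator_of g ?X2)"
      unfolding commuting_ops_def using X by (simp add: operator_of_mult[OF g_orthonormal g_full])
    then show ?L
      using extension_of_matrix[OF _ C(1,3), of 1] extension_of_matrix[OF _ C(2,4), of 2]
      by (intro canonical_solution_exists) auto
  }
qed

end

theorem proposition1:
  fixes s :: "nat \<times> nat \<Rightarrow> real" and r \<rho> :: nat and k :: "nat \<Rightarrow> nat \<times> nat"
    and A1 A2 B1 B2 :: "complex mat" and i\<^sub>s :: nat
  assumes "r \<ge> 1"
    and "s (0, 0) > 0"
    and "bij_betw k {0..\<rho>} (K_deg r)"
    and "\<forall>i\<in>{0..\<rho>}. \<forall>j\<in>{0..\<rho>}. k i \<in> K_deg (r - 1) \<and> k j \<notin> K_deg (r - 1) \<longrightarrow> i < j"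
    and "psd_mat (Gamma s k \<rho>)"
    and "\<forall>l\<in>{1, 2}. mat_kernel (Gamma_sub s k \<rho> l) \<subseteq> mat_kernel (Gamma_hat s k \<rho> l)"
    and "A1 = A_mat s k \<rho> 1" and "A2 = A_mat s k \<rho> 2"
    and "B1 = B_mat s k \<rho> 1" and "B2 = B_mat s k \<rho> 2"
    and "i\<^sub>s = nsa_index s k \<rho>"
    and "i\<^sub>s > 0"
    and "A1 * A2 + mat_adjoint B1 * B2 = A2 * A1 + mat_adjoint B2 * B1"
    and "mat_trace (B2 * mat_adjoint B1 - B1 * mat_adjoint B2) = 0"
  shows "(\<exists>\<mu>. canonical_solution s k \<rho> \<mu>) \<longleftrightarrow>
    (\<exists>C1 C2. C1 \<in> carrier_mat i\<^sub>s i\<^sub>s \<and> C2 \<in> carrier_mat i\<^sub>s i\<^sub>s \<and>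
       hermitian_mat C1 \<and> hermitian_mat C2 \<and>
       mat_adjoint B2 * C1 - mat_adjoint B1 * C2 = A1 * mat_adjoint B2 - A2 * mat_adjoint B1 \<and>
       C1 * C2 - C2 * C1 = B2 * mat_adjoint B1 - B1 * mat_adjoint B2)"
proof -
  interpret truncated_moments s k \<rho> r
    using assms(1,3-6) by unfold_locales
  show ?thesis
    using canonical_solution_iff assms(13) unfolding assms(7-11) .
qed

end
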